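(* Let $\mathcal U$ be a unitary 2-design on $\mathcal H$, let $\rho$ be a density operator on $\mathcal H$ and let $O$ be a traceless Hermitian operator on $\mathcal H$. Let $\mathcal E(O)=\{WOW^\dagger: W\in U(d)\}$ and $\mathcal E(\rho)=\{W\rho W^\dagger: W\in U(d)\}$, each equipped with the measure induced by the Haar measure on $W$. Write $V(\mathcal E(O),\rho)=\mathbb E_{W\sim\mathrm{Haar}}V(WOW^\dagger,\rho)$ and $V(O,\mathcal E(\rho))=\mathbb E_{W\sim\mathrm{Haar}}V(O,W\rho W^\dagger)$; define $V_*(\mathcal E(O),\rho)$ and $V_*(O,\mathcal E(\rho))$ analogously. Then $$V(\mathcal E(O),\rho)=V(O,\mathcal E(\rho))=\Bigl(1+\frac{d-\wp}{d^2-1}\Bigr)\|O\|_2^2,$$ $$V_*(\mathcal E(O),\rho)=V_*(O,\mathcal E(\rho))=\frac{d\wp-1}{d^2-1}\|O\|_2^2<\frac{\|O\|_2^2}{d},$$ where $\wp=\operatorname{tr}(\rho^2)$.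
   Context: Let $n\ge1$, $d=2^n$, and $\mathcal H=(\mathbb C^2)^{\otimes n}$ with computational basis $\{|\mathbf b\rangle\}_{\mathbf b\in\{0,1\}^n}$. A unitary ensemble $\mathcal U$ is a probability distribution on $U(d)$. Its measurement channel is $\mathcal M(X)=\mathbb E_{U\sim\mathcal U}\sum_{\mathbf b}\langle\mathbf b|UXU^\dagger|\mathbf b\rangle\,U^\dagger|\mathbf b\rangle\langle\mathbf b|U$, assumed invertible (for a unitary 2-design, $\mathcal M^{-1}(O)=(d+1)O-\operatorname{tr}(O)\mathbb 1$). For a density operator $\rho$ and a traceless Hermitian operator $O$ define $V(O,\rho)=\mathbb E_{U\sim\mathcal U}\sum_{\mathbf b}\langle\mathbf b|U\rho U^\dagger|\mathbf b\rangle\bigl(\langle\mathbf b|U\mathcal M^{-1}(O)U^\dagger|\mathbf b\rangle\bigr)^2-[\operatorname{tr}(O\rho)]^2$ (the single-shot classical-shadow variance) and $V_*(O,\rho)=\mathbb E_{U\sim\mathcal U}\bigl(\sum_{\mathbf b}\langle\mathbf b|U\rho U^\dagger|\mathbf b\rangle\langle\mathbf b|U\mathcal M^{-1}(O)U^\dagger|\mathbf b\rangle\bigr)^2-[\operatorname{tr}(O\rho)]^2$ (the thrifty-shadow overhead term; reusing each sampled unitary $R$ times gives variance $V/R+(R-1)V_*/R$). $\|O\|_2$ is the Hilbert–Schmidt norm.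
   Formalization: The strict inequality $<\|O\|_2^2/d$ is stated only for $O\neq 0$, since for $O=0$ (traceless Hermitian) it would read $0<0$; all equalities are stated for every $O$. *)

theory Defs
  imports "HOL-Probability.Probability"
begin

text \<open>Operators on the d-dimensional Hilbert space are matrices of type complex^'d^'d,
  with the standard basis indexed by the finite type 'd playing the role of the
  computational basis.\<close>

definition cadj :: "complex^'d^'d \<Rightarrow> complex^'d^'d" where
  "cadj A = (\<chi> i j. cnj (A $ j $ i))"

definition unitary_mat :: "complex^'d^'d \<Rightarrow> bool" where
  "unitary_mat U \<longleftrightarrow> U ** cadj U = mat 1 \<and> cadj U ** U = mat 1"

definition hermitian_mat :: "complex^'d^'d \<Rightarrow> bool" where
  "hermitian_mat A \<longleftrightarrow> cadj A = A"

definition ctrace :: "complex^'d^'d \<Rightarrow> complex" where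
  "ctrace A = (\<Sum>i\<in>UNIV. A $ i $ i)"

definition density_op :: "complex^'d^'d \<Rightarrow> bool" where
  "density_op \<rho> \<longleftrightarrow> hermitian_mat \<rho>
     \<and> (\<forall>v :: complex^'d. 0 \<le> Re (\<Sum>i\<in>UNIV. \<Sum>j\<in>UNIV. cnj (v $ i) * \<rho> $ i $ j * v $ j))
     \<and> ctrace \<rho> = 1"

definition hs_norm :: "complex^'d^'d \<Rightarrow> real" where
  "hs_norm A = sqrt (\<Sum>i\<in>UNIV. \<Sum>j\<in>UNIV. (cmod (A $ i $ j))\<^sup>2)"

definition unitary_ensemble :: "(complex^'d^'d) measure \<Rightarrow> bool" where
  "unitary_ensemble M \<longleftrightarrow> prob_space M \<and> sets M = sets borel \<and> (AE U in M. unitary_mat U)"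

definition haar_measure :: "(complex^'d^'d) measure \<Rightarrow> bool" where
  "haar_measure H \<longleftrightarrow> unitary_ensemble H \<and>
     (\<forall>W. unitary_mat W \<longrightarrow> distr H borel (\<lambda>U. W ** U) = H \<and> distr H borel (\<lambda>U. U ** W) = H)"

definition unitary_2_design :: "(complex^'d^'d) measure \<Rightarrow> bool" where
  "unitary_2_design M \<longleftrightarrow> unitary_ensemble M \<and>
     (\<forall>H. haar_measure H \<longrightarrow>
       (\<forall>i1 j1 i2 j2 k1 l1 k2 l2.
          (\<integral>U. U $ i1 $ j1 * U $ i2 $ j2 * cnj (U $ k1 $ l1) * cnj (U $ k2 $ l2) \<partial>M)
        = (\<integral>U. U $ i1 $ j1 * U $ i2 $ j2 * cnj (U $ k1 $ l1) * cnj (U $ k2 $ l2) \<partial>H)))"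

text \<open>Measurement channel M(X) = E_U sum_b <b|UXU^dag|b> U^dag|b><b|U.\<close>
definition meas_channel :: "(complex^'d^'d) measure \<Rightarrow> complex^'d^'d \<Rightarrow> complex^'d^'d" where
  "meas_channel M X = (\<integral>U. (\<chi> i j. \<Sum>b\<in>UNIV. (U ** X ** cadj U) $ b $ b * cnj (U $ b $ i) * U $ b $ j) \<partial>M)"

definition meas_inv :: "(complex^'d^'d) measure \<Rightarrow> complex^'d^'d \<Rightarrow> complex^'d^'d" where
  "meas_inv M A = (THE Y. meas_channel M Y = A)"

text \<open>Single-shot classical-shadow variance V(O,rho).  All quantities are real for
  Hermitian arguments; Re is only used for typing.\<close>
definition shadow_var :: "(complex^'d^'d) measure \<Rightarrow> complex^'d^'d \<Rightarrow> complex^'d^'d \<Rightarrow> real" where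
  "shadow_var M A \<rho> =
     (\<integral>U. (\<Sum>b\<in>UNIV. Re ((U ** \<rho> ** cadj U) $ b $ b) * (Re ((U ** meas_inv M A ** cadj U) $ b $ b))\<^sup>2) \<partial>M)
     - (Re (ctrace (A ** \<rho>)))\<^sup>2"

definition thrifty_var :: "(complex^'d^'d) measure \<Rightarrow> complex^'d^'d \<Rightarrow> complex^'d^'d \<Rightarrow> real" where
  "thrifty_var M A \<rho> =
     (\<integral>U. (\<Sum>b\<in>UNIV. Re ((U ** \<rho> ** cadj U) $ b $ b) * Re ((U ** meas_inv M A ** cadj U) $ b $ b))\<^sup>2 \<partial>M)
     - (Re (ctrace (A ** \<rho>)))\<^sup>2"

end

theory Submission
  imports Defs
begin

text \<open>Write \<open>P = W X W\<^sup>\<dagger>\<close> and \<open>Q = W Y W\<^sup>\<dagger>\<close> for a Haar random \<open>W\<close>. The tensor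
  \<open>E[P\<^sub>i\<^sub>j Q\<^sub>k\<^sub>l]\<close> is invariant under conjugation by \<open>V \<otimes> V\<close>, hence a combination of the identity
  and the swap; the traces of \<open>P\<close>, \<open>Q\<close> and \<open>P Q\<close> determine the coefficients, and a 2-design has
  the same tensor. This makes \<open>O \<mapsto> (d + 1) O - tr O\<close> the inverse of the measurement channel. The
  variance is of third order in \<open>U\<close>, so the design property does not apply to it directly. But after
  exchanging the integrals over \<open>U\<close> and \<open>W\<close>, invariance removes \<open>U\<close> from the inner Haar integral,
  and what is left for \<open>U\<close> is of second order.\<close>

section \<open>Conjugation, trace and Hermitian matrices\<close>

abbreviation uconj :: "complex^'d^'d \<Rightarrow> complex^'d^'d \<Rightarrow> complex^'d^'d" where
  "uconj U X \<equiv> U ** X ** cadj U"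

lemma cadj_nth [simp]: "cadj A $ i $ j = cnj (A $ j $ i)"
  by (simp add: cadj_def)

lemma matrix_mult_nth: "(A ** B) $ i $ j = (\<Sum>k\<in>UNIV. A $ i $ k * B $ k $ j)"
  by (simp add: matrix_matrix_mult_def)

lemma cadj_mult: "cadj (A ** B) = cadj B ** (cadj A :: complex^'d::finite^'d)"
  by (simp add: vec_eq_iff matrix_mult_nth mult.commute)

lemma cadj_cadj [simp]: "cadj (cadj A) = A"
  by (simp add: vec_eq_iff)

lemma uconj_mult: "uconj (V ** W) X = uconj V (uconj W X)"
  by (simp add: cadj_mult matrix_mul_assoc)

lemma uconj_nth:
  "uconj U X $ i $ j = (\<Sum>a\<in>UNIV. \<Sum>b\<in>UNIV. U $ i $ a * X $ a $ b * cnj (U $ j $ b))"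
  unfolding matrix_mult_nth cadj_nth sum_distrib_right by (rule sum.swap)

lemma hermitian_mat_uconj: "hermitian_mat X \<Longrightarrow> hermitian_mat (uconj U X)"
  by (simp add: hermitian_mat_def cadj_mult matrix_mul_assoc)

lemma hermitian_mat_nth: "hermitian_mat A \<Longrightarrow> cnj (A $ i $ j) = A $ j $ i"
  by (metis hermitian_mat_def cadj_nth)

lemma ctrace_mult: "ctrace (A ** B) = (\<Sum>i\<in>UNIV. \<Sum>j\<in>UNIV. A $ i $ j * B $ j $ i)"
  by (simp add: ctrace_def matrix_mult_nth)

lemma ctrace_mult_commute: "ctrace (A ** B) = ctrace (B ** A)"
  unfolding ctrace_mult by (subst sum.swap) (simp add: mult.commute)

lemma unitary_matI: "U ** cadj U = mat 1 \<Longrightarrow> unitary_mat U"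
  by (simp add: unitary_mat_def matrix_left_right_inverse)

lemma ctrace_uconj: "unitary_mat U \<Longrightarrow> ctrace (uconj U X) = ctrace X"
  by (metis unitary_mat_def ctrace_mult_commute matrix_mul_assoc matrix_mul_lid)

lemma uconj_mult_uconj: "unitary_mat U \<Longrightarrow> uconj U X ** uconj U Y = uconj U (X ** Y)"
  by (metis unitary_mat_def matrix_mul_assoc matrix_mul_lid)

lemma ctrace_hermitian_real:
  assumes "hermitian_mat A" "hermitian_mat B"
  shows "ctrace (A ** B) \<in> \<real>"
proof -
  have "cnj (ctrace (A ** B)) = ctrace (B ** A)"
    unfolding ctrace_mult using assms 
    by (simp add: hermitian_mat_nth mult.commute)
  then show ?thesis
    by (simp add: ctrace_mult_commute[of B] Reals_cnj_iff)
qed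

lemma hermitian_mat_mat1: "hermitian_mat (mat 1)"
  by (simp add: hermitian_mat_def vec_eq_iff mat_def)

lemma ctrace_real: "hermitian_mat A \<Longrightarrow> ctrace A \<in> \<real>"
  using ctrace_hermitian_real[of A "mat 1"] by (simp add: hermitian_mat_mat1)

lemma ctrace_mat1: "ctrace (mat 1 :: complex^'d::finite^'d) = of_nat CARD('d)"
  by (simp add: ctrace_def mat_def)

lemma hs_norm_hermitian:
  assumes "hermitian_mat A"
  shows "(hs_norm A)\<^sup>2 = Re (ctrace (A ** A))"
proof -
  have "A $ i $ j * A $ j $ i = of_real ((cmod (A $ i $ j))\<^sup>2)" for i j
    by (metis assms complex_norm_square hermitian_mat_nth)
  then show ?thesis
    by (simp add: hs_norm_def ctrace_mult sum_nonneg)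
qed

section \<open>Continuity, compactness of the unitary group, and integrability\<close>

lemma continuous_on_matrix_mult [continuous_intros]:
  fixes f g :: "'a::topological_space \<Rightarrow> complex^'d::finite^'d"
  assumes "continuous_on S f" "continuous_on S g"
  shows "continuous_on S (\<lambda>x. f x ** g x)"
  unfolding matrix_matrix_mult_def
  by (intro continuous_intros assms)

lemma continuous_on_cadj [continuous_intros]:
  fixes f :: "'a::topological_space \<Rightarrow> complex^'d::finite^'d"
  assumes "continuous_on S f"
  shows "continuous_on S (\<lambda>x. cadj (f x))"
  unfolding cadj_def by (intro continuous_intros assms)

lemma continuous_on_ctrace [continuous_intros]:
  fixes f :: "'a::topological_space \<Rightarrow> complex^'d::finite^'d"
  assumes "continuous_on S f"
  shows "continuous_on S (\<lambda>x. ctrace (f x))"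
  unfolding ctrace_def by (intro continuous_intros assms)

lemma unitary_mat_nth_le_1:
  assumes "unitary_mat (U :: complex^'d::finite^'d)"
  shows "cmod (U $ i $ j) \<le> 1"
proof -
  have "(\<Sum>k\<in>UNIV. U $ i $ k * cnj (U $ i $ k)) = 1"
    using assms by (simp add: unitary_mat_def vec_eq_iff matrix_mult_nth mat_def)
  then have "of_real (\<Sum>k\<in>UNIV. (cmod (U $ i $ k))\<^sup>2) = (1::complex)"
    by (simp only: of_real_sum complex_norm_square)
  then have "(\<Sum>k\<in>UNIV. (cmod (U $ i $ k))\<^sup>2) = 1"
    using of_real_eq_1_iff by blast
  then have "(cmod (U $ i $ j))\<^sup>2 \<le> 1"
    using member_le_sum[of j UNIV "\<lambda>k. (cmod (U $ i $ k))\<^sup>2"] by simp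
  then show ?thesis
    by (simp add: power_le_one_iff abs_square_le_1)
qed

lemma compact_unitary: "compact {U :: complex^'d::finite^'d. unitary_mat U}"
proof (rule compact_eq_bounded_closed[THEN iffD2, OF conjI])
  have "norm U \<le> (\<Sum>i::'d\<in>UNIV. \<Sum>j::'d\<in>UNIV. 1)" if "unitary_mat U" for U :: "complex^'d^'d"
  proof -
    have "norm U \<le> (\<Sum>i\<in>UNIV. norm (U $ i))"
      by (simp add: norm_vec_def L2_set_le_sum)
    also have "\<dots> \<le> (\<Sum>i\<in>UNIV. \<Sum>j\<in>UNIV. cmod (U $ i $ j))"
      by (intro sum_mono) (simp add: norm_vec_def L2_set_le_sum)
    also have "\<dots> \<le> (\<Sum>i::'d\<in>UNIV. \<Sum>j::'d\<in>UNIV. 1)"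
      by (intro sum_mono unitary_mat_nth_le_1 that)
    finally show ?thesis .
  qed
  then show "bounded {U :: complex^'d^'d. unitary_mat U}"
    unfolding bounded_iff by blast
  show "closed {U :: complex^'d^'d. unitary_mat U}"
    unfolding unitary_mat_def
    by (intro closed_Collect_conj closed_Collect_eq continuous_intros)
qed

text \<open>The measure lives on the compact unitary group, where a continuous function is bounded.
  Continuity alone therefore settles the integrability questions for one ensemble; \<open>f\<close>
  is taken continuous on all matrices because the ensembles are measures on that space.\<close>

lemma integrable_continuous_unitary:
  fixes f :: "complex^'d::finite^'d \<Rightarrow> 'b::{banach,second_countable_topology}"
  assumes M: "unitary_ensemble M" and f: "continuous_on UNIV f"
  shows "integrable M f"
proof -
  interpret prob_space M using M by (simp add: unitary_ensemble_def)
  have "sets M = sets borel" and AE: "AE U in M. unitary_mat U"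
    using M by (auto simp: unitary_ensemble_def)
  then have meas: "f \<in> borel_measurable M"
    using borel_measurable_continuous_onI[OF f] measurable_cong_sets by blast
  have "bounded (f ` {U. unitary_mat U})"
    by (intro compact_imp_bounded compact_continuous_image compact_unitary
        continuous_on_subset[OF f]) auto
  then obtain B where "\<And>U. unitary_mat U \<Longrightarrow> norm (f U) \<le> B"
    unfolding bounded_iff by blast
  with AE show ?thesis
    by (intro integrable_const_bound[OF _ meas]) (auto elim!: eventually_mono)
qed

text \<open>The same argument on the product of two unitary groups. Passing from the two
  almost-everywhere statements to the product requires the product set to be measurable, which
  follows since it is closed.\<close>

lemma integrable_continuous_unitary_pair:
  fixes f :: "(complex^'d::finite^'d) \<times> (complex^'d^'d) \<Rightarrow> 'b::{banach,second_countable_topology}"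
  assumes M: "unitary_ensemble M" and N: "unitary_ensemble N" and f: "continuous_on UNIV f"
  shows "integrable (M \<Otimes>\<^sub>M N) f"
proof -
  interpret M: prob_space M using M by (simp add: unitary_ensemble_def)
  interpret N: prob_space N using N by (simp add: unitary_ensemble_def)
  interpret pair_prob_space M N ..
  let ?K = "{U :: complex^'d::finite^'d. unitary_mat U}"
  have sets: "sets M = sets borel" "sets N = sets borel"
    and AE: "AE U in M. U \<in> ?K" "AE U in N. U \<in> ?K"
    using M N by (auto simp: unitary_ensemble_def)
  have MN: "sets (M \<Otimes>\<^sub>M N) = sets borel"
    using sets_pair_measure_cong[OF sets] unfolding borel_prod .
  then have meas: "f \<in> borel_measurable (M \<Otimes>\<^sub>M N)"
    using borel_measurable_continuous_onI[OF f] measurable_cong_sets by blast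
  have K: "compact (?K \<times> ?K)"
    by (intro compact_Times compact_unitary)
  have "bounded (f ` (?K \<times> ?K))"
    by (intro compact_imp_bounded compact_continuous_image K
        continuous_on_subset[OF f]) auto
  then obtain B where B: "\<And>z. z \<in> ?K \<times> ?K \<Longrightarrow> norm (f z) \<le> B"
    unfolding bounded_iff by blast
  have "?K \<times> ?K \<in> sets (M \<Otimes>\<^sub>M N)"
    unfolding MN using K by (intro borel_closed compact_imp_closed)
  then have "{z \<in> space (M \<Otimes>\<^sub>M N). z \<in> ?K \<times> ?K} \<in> sets (M \<Otimes>\<^sub>M N)"
    by (simp only: sets_eq_imp_space_eq[OF MN] space_borel UNIV_I simp_thms Collect_mem_eq)
  then have "AE z in M \<Otimes>\<^sub>M N. z \<in> ?K \<times> ?K"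
    using AE by (intro AE_pair_measure) (auto elim!: eventually_mono)
  then show ?thesis
    by (intro integrable_const_bound[OF _ meas, of B]) (auto elim!: eventually_mono simp: B)
qed

lemma integral_haar_left:
  fixes f :: "complex^'d::finite^'d \<Rightarrow> 'b::{banach,second_countable_topology}"
  assumes H: "haar_measure H" and V: "unitary_mat V" and f: "continuous_on UNIV f"
  shows "(\<integral>W. f (V ** W) \<partial>H) = (\<integral>W. f W \<partial>H)"
proof -
  have "sets H = sets borel" and eq: "distr H borel ((**) V) = H"
    using H V by (auto simp: haar_measure_def unitary_ensemble_def)
  moreover have "continuous_on UNIV (\<lambda>W :: complex^'d^'d. V ** W)"
    by (intro continuous_intros)
  ultimately have "(**) V \<in> H \<rightarrow>\<^sub>M borel"
    using borel_measurable_continuous_onI measurable_cong_sets by blast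
  then have "(\<integral>W. f W \<partial>distr H borel ((**) V)) = (\<integral>W. f (V ** W) \<partial>H)"
    by (intro integral_distr borel_measurable_continuous_onI[OF f])
  with eq show ?thesis by simp
qed

section \<open>The second-moment tensor of the Haar measure\<close>

text \<open>With \<open>d = CARD('d)\<close>, \<open>id_coeff\<close> and \<open>swap_coeff\<close>
  are the solution \<open>a\<close>, \<open>b\<close> of the system
  \<open>tr X * tr Y = a * d^2 + b * d\<close>, \<open>tr (X ** Y) = a * d + b * d^2\<close>. These
  are the Weingarten coefficients of order two.\<close>

definition id_coeff :: "complex^'d^'d \<Rightarrow> complex^'d^'d \<Rightarrow> complex" where
  "id_coeff X Y = (ctrace X * ctrace Y - ctrace (X ** Y) / of_nat CARD('d)) / ((of_nat CARD('d))\<^sup>2 - 1)"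

definition swap_coeff :: "complex^'d^'d \<Rightarrow> complex^'d^'d \<Rightarrow> complex" where
  "swap_coeff X Y = (ctrace (X ** Y) - ctrace X * ctrace Y / of_nat CARD('d)) / ((of_nat CARD('d))\<^sup>2 - 1)"

lemma unitary_mat_diag:
  assumes "\<And>i. cmod (z i) = 1"
  shows "unitary_mat (\<chi> i j :: 'd::finite. if i = j then z i else 0)"
proof (rule unitary_matI)
  have "z i * cnj (z i) = 1" for i
    using assms[of i] complex_norm_square[of "z i"] by simp
  then show "(\<chi> i j. if i = j then z i else 0) ** cadj (\<chi> i j. if i = j then z i else 0) = mat 1"
    by (auto simp: vec_eq_iff matrix_mult_nth mat_def if_distrib[of cnj]
        if_distrib[of "\<lambda>x. x * _"] if_distrib[of "\<lambda>x. _ * x"] cong: if_cong)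
qed

lemma uconj_diag_nth:
  "uconj (\<chi> i j :: 'd::finite. if i = j then z i else 0) X $ i $ j = z i * cnj (z j) * X $ i $ j"
  by (simp add: matrix_mult_nth if_distrib[of cnj]
        if_distrib[of "\<lambda>x. x * _"] if_distrib[of "\<lambda>x. _ * x"] cong: if_cong)

lemma unitary_mat_perm:
  assumes "inj \<pi>"
  shows "unitary_mat (\<chi> i j :: 'd::finite. if j = \<pi> i then 1 else 0)"
proof (rule unitary_matI)
  show "(\<chi> i j. if j = \<pi> i then 1 else 0) ** cadj (\<chi> i j. if j = \<pi> i then 1 else 0) = mat 1"
    using injD[OF assms]
    by (auto simp: vec_eq_iff matrix_mult_nth mat_def if_distrib[of cnj]
        if_distrib[of "\<lambda>x. x * _"] if_distrib[of "\<lambda>x. _ * x"] cong: if_cong)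
qed

lemma uconj_perm_nth:
  "uconj (\<chi> i j :: 'd::finite. if j = \<pi> i then 1 else 0) X $ i $ j = X $ \<pi> i $ \<pi> j"
  by (simp add: matrix_mult_nth if_distrib[of cnj]
        if_distrib[of "\<lambda>x. x * _"] if_distrib[of "\<lambda>x. _ * x"] cong: if_cong)

text \<open>The witness is the Hadamard gate on the levels \<open>p\<close> and \<open>q\<close>,
  extended by the identity. It mixes diagonal and off-diagonal entries, which neither diagonal
  unitaries nor permutations do.\<close>

lemma hadamard_unitary:
  fixes p q :: "'d::finite"
  assumes "p \<noteq> q"
  obtains V :: "complex^'d^'d" where "unitary_mat V"
    "\<And>X. uconj V X $ p $ p = (X $ p $ p + X $ p $ q + X $ q $ p + X $ q $ q) / 2"
proof
  define s :: complex where "s = of_real (1 / sqrt 2)"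
  have s: "s * s = 1/2" "cnj s = s"
    unfolding s_def by (simp_all flip: of_real_mult)
  have s': "s * (s * x) = x / 2" for x
    by (simp add: s(1) flip: mult.assoc)
  define V :: "complex^'d^'d" where
    "V = (\<chi> i k. if k = p then (if i = p \<or> i = q then s else 0)
      else if k = q then (if i = p then s else if i = q then - s else 0) else if i = k then 1 else 0)"
  have V_p: "V $ i $ p = (if i = p \<or> i = q then s else 0)"
    and V_q: "V $ i $ q = (if i = p then s else if i = q then - s else 0)"
    and V_other: "k \<noteq> p \<Longrightarrow> k \<noteq> q \<Longrightarrow> V $ i $ k = (if i = k then 1 else 0)" for i k
    using assms by (auto simp: V_def)
  \<comment> \<open>The action of \<open>V\<close> on an arbitrary vector \<open>f\<close>, split
    into the two active levels and the rest. It serves both for unitarity and for the entry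
    formula.\<close>
  have row: "(\<Sum>k\<in>UNIV. V $ i $ k * f k)
    = (if i = p then s * (f p + f q) else if i = q then s * (f p - f q) else f i)" for i f
  proof -
    have "(\<Sum>k\<in>UNIV. V $ i $ k * f k)
      = (\<Sum>k\<in>UNIV - {p, q}. V $ i $ k * f k) + (\<Sum>k\<in>{p, q}. V $ i $ k * f k)"
      by (rule sum.subset_diff) auto
    also have "(\<Sum>k\<in>UNIV - {p, q}. V $ i $ k * f k) = (\<Sum>k\<in>UNIV - {p, q}. if k = i then f k else 0)"
      by (intro sum.cong refl) (auto simp: V_other)
    also have "\<dots> = (if i = p \<or> i = q then 0 else f i)"
      by simp
    also have "(\<Sum>k\<in>{p, q}. V $ i $ k * f k) = V $ i $ p * f p + V $ i $ q * f q"
      using assms by simp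
    finally show ?thesis
      using assms by (auto simp: V_p V_q algebra_simps)
  qed
  have real: "cnj (V $ i $ k) = V $ i $ k" for i k
    by (simp add: V_def s)
  show "unitary_mat V"
  proof (rule unitary_matI)
    have "(V ** cadj V) $ i $ j = mat 1 $ i $ j" for i j
      unfolding matrix_mult_nth cadj_nth real row V_p V_q using assms
      by (auto simp: mat_def V_other ring_distribs s mult.left_commute[of s 2])
    then show "V ** cadj V = mat 1" by (simp add: vec_eq_iff)
  qed
  show "uconj V X $ p $ p = (X $ p $ p + X $ p $ q + X $ q $ p + X $ q $ q) / 2" for X
  proof -
    have VX: "(V ** X) $ p $ k = s * (X $ p $ k + X $ q $ k)" for k
      by (simp add: matrix_mult_nth row)
    have "uconj V X $ p $ p = (\<Sum>k\<in>UNIV. V $ p $ k * (V ** X) $ p $ k)"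
      unfolding matrix_mult_nth[of "V ** X"] cadj_nth real by (simp only: mult.commute)
    also have "\<dots> = s * (s * (X $ p $ p + X $ q $ p) + s * (X $ p $ q + X $ q $ q))"
      by (simp add: row VX)
    also have "\<dots> = (X $ p $ p + X $ p $ q + X $ q $ p + X $ q $ q) / 2"
      unfolding ring_distribs s' by (simp add: add_divide_distrib)
    finally show ?thesis .
  qed
qed

text \<open>Left invariance, tested on three explicit families of unitaries, reduces the tensor to
  two constants. Contracting it in two ways then gives two linear equations for them;
  \<open>d \<ge> 2\<close> makes the system nonsingular.\<close>

lemma twirl_haar:
  fixes H :: "(complex^'d::finite^'d) measure"
  assumes H: "haar_measure H" and d: "CARD('d) \<ge> 2"
  shows "(\<integral>W. uconj W X $ i $ j * uconj W Y $ k $ l \<partial>H)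
       = (if i = j \<and> k = l then id_coeff X Y else 0) + (if i = l \<and> k = j then swap_coeff X Y else 0)"
proof -
  interpret prob_space H using H by (simp add: haar_measure_def unitary_ensemble_def)
  have ens: "unitary_ensemble H" and AE: "AE W in H. unitary_mat W"
    using H by (auto simp: haar_measure_def unitary_ensemble_def)
  define t where "t i j k l = (\<integral>W. uconj W X $ i $ j * uconj W Y $ k $ l \<partial>H)" for i j k l
  have int: "integrable H (\<lambda>W. uconj W X $ i $ j * uconj W Y $ k $ l)" for i j k l
    by (intro integrable_continuous_unitary[OF ens] continuous_intros)
  have inv: "t i j k l = (\<integral>W. uconj V (uconj W X) $ i $ j * uconj V (uconj W Y) $ k $ l \<partial>H)"
    if "unitary_mat V" for V i j k l
  proof -
    have "continuous_on UNIV (\<lambda>W. uconj W X $ i $ j * uconj W Y $ k $ l)"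
      by (intro continuous_intros)
    from integral_haar_left[OF H that this] show ?thesis
      by (simp add: t_def uconj_mult)
  qed
  \<comment> \<open>Invariance under diagonal unitaries kills all entries outside the identity and swap patterns,
    permutations leave three constants, and the Hadamard gate on two levels relates them.\<close>
  have phase: "t i j k l = z i * cnj (z j) * z k * cnj (z l) * t i j k l"
    if "\<And>i. cmod (z i) = 1" for z i j k l
    unfolding t_def using inv[OF unitary_mat_diag[OF that], of i j k l]
    by (simp add: uconj_diag_nth t_def mult.assoc mult.left_commute[of "uconj _ _ $ _ $ _"])
  have perm: "t (\<pi> i) (\<pi> j) (\<pi> k) (\<pi> l) = t i j k l" if "inj \<pi>" for \<pi> i j k l
    using inv[OF unitary_mat_perm[OF that], of i j k l] by (simp add: uconj_perm_nth t_def)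
  have zero: "t i j k l = 0" if "\<not> (i = j \<and> k = l)" "\<not> (i = l \<and> k = j)" for i j k l
  proof (rule ccontr)
    assume "t i j k l \<noteq> 0"
    then have "z i * cnj (z j) * z k * cnj (z l) = 1" if "\<And>i. cmod (z i) = 1" for z
      using phase[OF that, of i j k l] by simp
    \<comment> \<open>The phase is the imaginary unit at the single index \<open>m\<close>. It
      enters with an exponent between -2 and 2, so the product equals 1 only for exponent 0. A sign
      -1 would not separate exponent 2 from 0, that is, the pattern \<open>i = k\<close>,
      \<open>j = l\<close>.\<close>
    note * = this[of "\<lambda>x. if x = m then \<i> else 1" for m]
    show False
      using *[of i] *[of k] *[of j] *[of l] that by (auto split: if_splits simp: complex_eq_iff)
  qed
  have "\<not> CARD('d) \<le> Suc 0" using d by simp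
  then obtain p q :: 'd where pq: "p \<noteq> q"
    unfolding card_le_Suc0_iff_eq[OF finite_class.finite_UNIV] by blast
  define \<alpha> where "\<alpha> = t p p q q"
  define \<beta> where "\<beta> = t p q q p"
  have move: "\<exists>\<pi>. inj \<pi> \<and> \<pi> p = i \<and> \<pi> q = k" if "i \<noteq> k" for i k :: 'd
  proof -
    \<comment> \<open>First \<open>p\<close> is sent to \<open>i\<close>. The second transposition
      carries the image of \<open>q\<close> to \<open>k\<close> and fixes \<open>i\<close>, which
      differs from both.\<close>
    define \<sigma> where "\<sigma> = Transposition.transpose i p"
    define \<tau> where "\<tau> = Transposition.transpose k (\<sigma> q)"
    have "inj (\<tau> \<circ> \<sigma>)" unfolding \<sigma>_def \<tau>_def by (intro inj_compose inj_transpose)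
    moreover have "\<sigma> p = i" "\<sigma> q \<noteq> i" using pq by (auto simp: \<sigma>_def Transposition.transpose_def)
    then have "(\<tau> \<circ> \<sigma>) p = i" "(\<tau> \<circ> \<sigma>) q = k" using that by (auto simp: \<tau>_def Transposition.transpose_def)
    ultimately show ?thesis by blast
  qed
  have \<alpha>: "t i i k k = \<alpha>" and \<beta>: "t i k k i = \<beta>" if "i \<noteq> k" for i k
  proof -
    obtain \<pi> where "inj \<pi>" "\<pi> p = i" "\<pi> q = k"
      using move[OF \<open>i \<noteq> k\<close>] by blast
    then show "t i i k k = \<alpha>" "t i k k i = \<beta>"
      using perm[of \<pi> p p q q] perm[of \<pi> p q q p] by (simp_all add: \<alpha>_def \<beta>_def)
  qed
  have \<gamma>: "t i i i i = t p p p p" for i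
    using perm[of "Transposition.transpose i p" p p p p] by (simp add: Transposition.transpose_def)
  \<comment> \<open>The Hadamard gate expresses this entry as a quarter of 16 entries on the levels
    \<open>p\<close>, \<open>q\<close>. Six survive: two fully diagonal ones, two equal to
    \<open>\<alpha>\<close> and two equal to \<open>\<beta>\<close>. Hence the entry is the mean of
    itself and \<open>\<alpha> + \<beta>\<close>.\<close>
  have "t p p p p = \<alpha> + \<beta>"
  proof -
    obtain V :: "complex^'d^'d" where V: "unitary_mat V"
      "\<And>X. uconj V X $ p $ p = (X $ p $ p + X $ p $ q + X $ q $ p + X $ q $ q) / 2"
      using hadamard_unitary[OF pq] by metis
    define S where "S = {(p,p),(p,q),(q,p),(q,q)}"
    have VS: "uconj V Z $ p $ p = (\<Sum>z\<in>S. Z $ fst z $ snd z) / 2" for Z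
      unfolding V(2) S_def using pq by simp
    have "t p p p p = (\<integral>W. (\<Sum>z\<in>S. \<Sum>w\<in>S. uconj W X $ fst z $ snd z * uconj W Y $ fst w $ snd w) / 4 \<partial>H)"
      unfolding inv[OF V(1)] VS times_divide_times_eq sum_product by simp
    also have "\<dots> = (\<Sum>z\<in>S. \<Sum>w\<in>S. t (fst z) (snd z) (fst w) (snd w)) / 4"
      by (simp add: Bochner_Integration.integral_sum int t_def)
    also have "\<dots> = (t p p p p + \<alpha> + \<beta>) / 2"
      unfolding S_def using pq by (simp add: zero \<alpha> \<beta> \<gamma>[of q])
    finally show ?thesis by (simp add: field_simps)
  qed
  then have t: "t i j k l = (if i = j \<and> k = l then \<alpha> else 0) + (if i = l \<and> k = j then \<beta> else 0)" for i j k l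
    using \<alpha> \<beta> \<gamma> zero by (cases "i = j"; cases "k = l"; cases "i = k"; auto)
  define D :: complex where "D = of_nat CARD('d)"
  \<comment> \<open>Both contractions are integrals of functions that are constant on unitaries,
    because conjugation preserves traces and products.\<close>
  have "ctrace X * ctrace Y = (\<Sum>i\<in>UNIV. \<Sum>k\<in>UNIV. t i i k k)"
  proof -
    have "(\<Sum>i\<in>UNIV. \<Sum>k\<in>UNIV. t i i k k) = (\<integral>W. ctrace (uconj W X) * ctrace (uconj W Y) \<partial>H)"
      by (simp add: t_def Bochner_Integration.integral_sum int ctrace_def sum_product)
    also have "\<dots> = (\<integral>W. ctrace X * ctrace Y \<partial>H)"
      using AE by (intro integral_cong_AE borel_measurable_integrable integrable_continuous_unitary[OF ens]
           continuous_intros) (auto elim!: eventually_mono simp: ctrace_uconj)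
    finally show ?thesis by (simp add: prob_space)
  qed
  also have "\<dots> = (\<Sum>i\<in>(UNIV::'d set). \<Sum>k\<in>(UNIV::'d set). \<alpha> + (if k = i then \<beta> else 0))"
    unfolding t by (intro sum.cong) auto
  also have "\<dots> = \<alpha> * D\<^sup>2 + \<beta> * D"
    by (simp add: sum.distrib D_def power2_eq_square algebra_simps)
  finally have 1: "ctrace X * ctrace Y = \<alpha> * D\<^sup>2 + \<beta> * D" .
  have "ctrace (X ** Y) = (\<Sum>i\<in>UNIV. \<Sum>k\<in>UNIV. t i k k i)"
  proof -
    have "(\<Sum>i\<in>UNIV. \<Sum>k\<in>UNIV. t i k k i) = (\<integral>W. ctrace (uconj W X ** uconj W Y) \<partial>H)"
      by (simp add: t_def Bochner_Integration.integral_sum int ctrace_mult)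
    also have "\<dots> = (\<integral>W. ctrace (X ** Y) \<partial>H)"
      using AE by (intro integral_cong_AE borel_measurable_integrable integrable_continuous_unitary[OF ens]
           continuous_intros) (auto elim!: eventually_mono simp: ctrace_uconj uconj_mult_uconj)
    finally show ?thesis by (simp add: prob_space)
  qed
  also have "\<dots> = (\<Sum>i\<in>(UNIV::'d set). \<Sum>k\<in>(UNIV::'d set). \<beta> + (if k = i then \<alpha> else 0))"
    unfolding t by (intro sum.cong) auto
  also have "\<dots> = \<beta> * D\<^sup>2 + \<alpha> * D"
    by (simp add: sum.distrib D_def power2_eq_square algebra_simps)
  finally have 2: "ctrace (X ** Y) = \<beta> * D\<^sup>2 + \<alpha> * D" .
  have "D \<noteq> 0" "D\<^sup>2 \<noteq> 1"
    using d unfolding D_def by (simp_all flip: of_nat_power)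
  \<comment> \<open>The two equations differ by exchanging \<open>\<alpha>\<close> and
    \<open>\<beta>\<close>, so a single cancellation yields both coefficients.\<close>
  then have solve: "(x * D\<^sup>2 + y * D - (y * D\<^sup>2 + x * D) / D) / (D\<^sup>2 - 1) = x" for x y
  proof -
    have "(y * D\<^sup>2 + x * D) / D = y * D + x"
      using \<open>D \<noteq> 0\<close> by (simp add: add_divide_distrib power2_eq_square)
    then have "x * D\<^sup>2 + y * D - (y * D\<^sup>2 + x * D) / D = x * (D\<^sup>2 - 1)"
      by (simp add: algebra_simps)
    then show ?thesis using \<open>D\<^sup>2 \<noteq> 1\<close> by simp
  qed
  have "id_coeff X Y = \<alpha>" "swap_coeff X Y = \<beta>"
    unfolding id_coeff_def swap_coeff_def D_def[symmetric] 1 2 by (rule solve)+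
  then show ?thesis unfolding t_def[symmetric] by (simp only: t)
qed

section \<open>Consequences of the second-moment formula\<close>

text \<open>The right-hand side contains exactly the moments, two entries of \<open>U\<close> and
  two conjugated ones, that a 2-design shares with the Haar measure.\<close>

lemma integral_uconj_eq_moments:
  fixes M :: "(complex^'d::finite^'d) measure"
  assumes "unitary_ensemble M"
  shows "(\<integral>U. uconj U X $ i $ j * uconj U Y $ k $ l \<partial>M)
    = (\<Sum>a\<in>UNIV. \<Sum>c\<in>UNIV. \<Sum>b\<in>UNIV. \<Sum>e\<in>UNIV. X $ a $ b * Y $ c $ e *
        (\<integral>U. U $ i $ a * U $ k $ c * cnj (U $ j $ b) * cnj (U $ l $ e) \<partial>M))"
proof -
  have "integrable M (\<lambda>U. U $ i $ a * U $ k $ c * cnj (U $ j $ b) * cnj (U $ l $ e))" for a b c e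
    by (intro integrable_continuous_unitary[OF assms] continuous_intros)
  moreover have "uconj U X $ i $ j * uconj U Y $ k $ l
    = (\<Sum>a\<in>UNIV. \<Sum>c\<in>UNIV. \<Sum>b\<in>UNIV. \<Sum>e\<in>UNIV. X $ a $ b * Y $ c $ e *
        (U $ i $ a * U $ k $ c * cnj (U $ j $ b) * cnj (U $ l $ e)))" for U
    unfolding uconj_nth sum_product
    by (intro sum.cong refl) (simp add: mult_ac)
  ultimately show ?thesis
    by (simp add: Bochner_Integration.integral_sum)
qed

text \<open>Turns a real weighted sum of diagonal entries into the trace against a Hermitian matrix,
  so that one trace formula covers all measurement statistics.\<close>

definition diag_mat :: "('d \<Rightarrow> real) \<Rightarrow> complex^'d^'d" where
  "diag_mat p = (\<chi> i j. if i = j then of_real (p i) else 0)"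

lemma hermitian_mat_diag_mat: "hermitian_mat (diag_mat p)"
  by (auto simp: hermitian_mat_def diag_mat_def vec_eq_iff)

lemma ctrace_diag_mat: "ctrace (diag_mat p) = of_real (\<Sum>b\<in>UNIV. p b)"
  by (simp add: ctrace_def diag_mat_def)

lemma ctrace_diag_mat_mult: "ctrace (diag_mat p ** Z) = (\<Sum>b\<in>UNIV. of_real (p b) * Z $ b $ b)"
  by (simp add: ctrace_mult diag_mat_def if_distrib[of "\<lambda>x. x * _"] cong: if_cong)

text \<open>The tensor formula is made an assumption so that its consequences apply alike to the
  Haar measure, for the average over \<open>W\<close>, and to the 2-design, for the average over
  \<open>U\<close>.\<close>

locale twirling_ensemble =
  fixes M :: "(complex^'d::finite^'d) measure"
  assumes ensemble: "unitary_ensemble M"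
    and dim: "CARD('d) \<ge> 2"
    and twirl: "(\<integral>U. uconj U X $ i $ j * uconj U Y $ k $ l \<partial>M)
       = (if i = j \<and> k = l then id_coeff X Y else 0) + (if i = l \<and> k = j then swap_coeff X Y else 0)"
begin

sublocale prob_space M using ensemble by (simp add: unitary_ensemble_def)

lemma AE_unitary: "AE U in M. unitary_mat U"
  using ensemble by (simp add: unitary_ensemble_def)

lemma integrable_cont: "continuous_on UNIV f \<Longrightarrow> integrable M f"
  for f :: "complex^'d^'d \<Rightarrow> 'b::{banach,second_countable_topology}"
  by (rule integrable_continuous_unitary[OF ensemble])

lemma integral_cong_unitary:
  fixes f g :: "complex^'d^'d \<Rightarrow> 'b::{banach,second_countable_topology}"
  assumes "continuous_on UNIV f" "continuous_on UNIV g" "\<And>U. unitary_mat U \<Longrightarrow> f U = g U"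
  shows "(\<integral>U. f U \<partial>M) = (\<integral>U. g U \<partial>M)"
  using AE_unitary assms
  by (intro integral_cong_AE borel_measurable_integrable integrable_cont) (auto elim!: eventually_mono)

text \<open>Contracting the tensor with \<open>A\<close> and \<open>B\<close>: the identity pattern
  produces the product of the traces, the swap pattern the trace of the product.\<close>

lemma integral_ctrace_ctrace:
  "(\<integral>U. ctrace (A ** uconj U X) * ctrace (B ** uconj U Y) \<partial>M)
    = id_coeff X Y * (ctrace A * ctrace B) + swap_coeff X Y * ctrace (A ** B)"
proof -
  have int: "integrable M (\<lambda>U. uconj U X $ i $ j * uconj U Y $ k $ l)" for i j k l
    by (intro integrable_cont continuous_intros)
  have "ctrace (A ** uconj U X) * ctrace (B ** uconj U Y) =
    (\<Sum>i\<in>UNIV. \<Sum>k\<in>UNIV. \<Sum>j\<in>UNIV. \<Sum>l\<in>UNIV. A $ i $ j * B $ k $ l * (uconj U X $ j $ i * uconj U Y $ l $ k))" for U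
    unfolding ctrace_mult sum_product by (intro sum.cong refl) (simp add: mult_ac)
  then have "(\<integral>U. ctrace (A ** uconj U X) * ctrace (B ** uconj U Y) \<partial>M) =
    (\<Sum>i\<in>UNIV. \<Sum>k\<in>UNIV. \<Sum>j\<in>UNIV. \<Sum>l\<in>UNIV. A $ i $ j * B $ k $ l * 
      ((if j = i \<and> l = k then id_coeff X Y else 0) + (if j = k \<and> l = i then swap_coeff X Y else 0)))"
    by (simp add: Bochner_Integration.integral_sum int twirl)
  \<comment> \<open>Each pair of index conditions becomes two nested single conditions, in the order
    of the inner sums, so that both sums collapse.\<close>
  also have "\<dots> = (\<Sum>i\<in>UNIV. \<Sum>k\<in>UNIV. \<Sum>j\<in>UNIV. \<Sum>l\<in>UNIV. 
      (if l = k then if j = i then A $ i $ j * B $ k $ l * id_coeff X Y else 0 else 0)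
      + (if l = i then if j = k then A $ i $ j * B $ k $ l * swap_coeff X Y else 0 else 0))"
    by (intro sum.cong refl) (auto simp: algebra_simps)
  also have "\<dots> = id_coeff X Y * (ctrace A * ctrace B) + swap_coeff X Y * ctrace (A ** B)"
  proof -
    have "ctrace A * ctrace B = (\<Sum>i\<in>UNIV. \<Sum>k\<in>UNIV. A $ i $ i * B $ k $ k)"
      unfolding ctrace_def sum_product ..
    then show ?thesis
      by (simp add: sum.distrib ctrace_mult sum_distrib_left mult_ac)
  qed
  finally show ?thesis .
qed

lemma integral_Re_ctrace_sq:
  assumes "hermitian_mat A" "hermitian_mat X"
  shows "(\<integral>U. (Re (ctrace (A ** uconj U X)))\<^sup>2 \<partial>M)
    = Re (id_coeff X X) * (Re (ctrace A))\<^sup>2 + Re (swap_coeff X X) * Re (ctrace (A ** A))"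
proof -
  have "ctrace (A ** uconj U X) \<in> \<real>" for U
    using assms by (intro ctrace_hermitian_real hermitian_mat_uconj)
  then have *: "(Re (ctrace (A ** uconj U X)))\<^sup>2 = Re (ctrace (A ** uconj U X) * ctrace (A ** uconj U X))" for U
    by (simp add: complex_is_Real_iff power2_eq_square)
  have "(\<integral>U. (Re (ctrace (A ** uconj U X)))\<^sup>2 \<partial>M)
    = Re (id_coeff X X * (ctrace A * ctrace A) + swap_coeff X X * ctrace (A ** A))"
    unfolding * integral_ctrace_ctrace[symmetric]
    by (intro integral_Re integrable_cont continuous_intros)
  also have "\<dots> = Re (id_coeff X X) * (Re (ctrace A))\<^sup>2 + Re (swap_coeff X X) * Re (ctrace (A ** A))"
    using ctrace_real[OF assms(1)] ctrace_hermitian_real[OF assms(1,1)]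
    by (simp add: complex_is_Real_iff power2_eq_square)
  finally show ?thesis .
qed

text \<open>The first moment is a special case of the second: with \<open>B\<close> and
  \<open>Y\<close> the identity, the second factor is the constant \<open>d\<close> on unitaries,
  and the swap coefficient vanishes.\<close>

lemma integral_ctrace: "(\<integral>U. ctrace (A ** uconj U X) \<partial>M) = ctrace A * ctrace X / of_nat CARD('d)"
proof -
  have d: "of_nat CARD('d) \<noteq> (0::complex)" "(of_nat CARD('d))\<^sup>2 \<noteq> (1::complex)"
    using dim by (simp_all flip: of_nat_power)
  have "(\<integral>U. ctrace (A ** uconj U X) * of_nat CARD('d) \<partial>M)
      = (\<integral>U. ctrace (A ** uconj U X) * ctrace (mat 1 ** uconj U (mat 1)) \<partial>M)"
    by (intro integral_cong_unitary continuous_intros) (simp add: unitary_mat_def ctrace_mat1)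
  also have "\<dots> = ctrace A * ctrace X"
  proof -
    have "x * D - x / D = x / D * (D\<^sup>2 - 1)" if "D \<noteq> 0" for x D :: complex
      using that by (simp add: power2_eq_square right_diff_distrib)
    from this[OF d(1)] have "id_coeff X (mat 1) = ctrace X / of_nat CARD('d)"
      using d by (simp add: id_coeff_def ctrace_mat1)
    moreover have "swap_coeff X (mat 1) = 0"
      using d by (simp add: swap_coeff_def ctrace_mat1)
    ultimately show ?thesis
      unfolding integral_ctrace_ctrace using d by (simp add: ctrace_mat1)
  qed
  finally have "(\<integral>U. ctrace (A ** uconj U X) \<partial>M) * of_nat CARD('d) = ctrace A * ctrace X"
    by simp
  then show ?thesis using d by (simp add: eq_divide_eq)
qed

lemma integral_diag_sum_sq:
  assumes "hermitian_mat X"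
  shows "(\<integral>U. (\<Sum>b\<in>UNIV. p b * Re (uconj U X $ b $ b))\<^sup>2 \<partial>M)
    = Re (id_coeff X X) * (\<Sum>b\<in>UNIV. p b)\<^sup>2 + Re (swap_coeff X X) * (\<Sum>b\<in>UNIV. (p b)\<^sup>2)"
proof -
  have "ctrace (diag_mat p ** diag_mat p) = of_real (\<Sum>b\<in>UNIV. (p b)\<^sup>2)"
    by (simp add: ctrace_diag_mat_mult) (simp add: diag_mat_def power2_eq_square)
  then show ?thesis
    using integral_Re_ctrace_sq[OF hermitian_mat_diag_mat assms, of p]
    by (simp add: ctrace_diag_mat_mult ctrace_diag_mat)
qed

lemma integral_diag_nth_sq:
  assumes "hermitian_mat X"
  shows "(\<integral>U. (Re (uconj U X $ b $ b))\<^sup>2 \<partial>M) = Re (id_coeff X X) + Re (swap_coeff X X)"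
  using integral_diag_sum_sq[OF assms, of "\<lambda>c. of_bool (c = b)"]
  by (simp add: of_bool_def if_distrib[of "\<lambda>x. x * _"] if_distrib[of "\<lambda>x. x ^ _"] cong: if_cong)

lemma integral_diag_nth:
  shows "(\<integral>U. Re (uconj U X $ b $ b) \<partial>M) = Re (ctrace X) / CARD('d)"
proof -
  have "ctrace (diag_mat (\<lambda>c. of_bool (c = b)) ** Z) = Z $ b $ b" for Z
    by (simp add: ctrace_diag_mat_mult of_bool_def if_distrib[of "\<lambda>x. x * _"] if_distrib[of of_real] cong: if_cong)
  then have "(\<integral>U. uconj U X $ b $ b \<partial>M) = ctrace X / of_nat CARD('d)"
    using integral_ctrace[of "diag_mat (\<lambda>c. of_bool (c = b))" X]
    by (simp add: ctrace_diag_mat)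
  moreover have "(\<integral>U. Re (uconj U X $ b $ b) \<partial>M) = Re (\<integral>U. uconj U X $ b $ b \<partial>M)"
    by (intro integral_Re integrable_cont continuous_intros)
  ultimately show ?thesis by simp
qed

text \<open>For a diagonal entry paired with itself the identity and swap patterns coincide, so only
  the sum of the coefficients matters; in it a factor \<open>d - 1\<close> cancels.\<close>

lemma coeff_sum: "id_coeff X Y + swap_coeff X Y
  = (ctrace X * ctrace Y + ctrace (X ** Y)) / (of_nat CARD('d) * (of_nat CARD('d) + 1))"
  for X Y :: "complex^'d^'d"
proof -
  have *: "(a - b / c) / (c\<^sup>2 - 1) + (b - a / c) / (c\<^sup>2 - 1) = (a + b) / (c * (c + 1))"
    if "c \<noteq> 0" "c - 1 \<noteq> 0" for a b c :: complex
  proof -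
    have "(a - b / c) + (b - a / c) = (c - 1) * ((a + b) / c)"
      using that by (simp add: field_simps)
    moreover have "c\<^sup>2 - 1 = (c - 1) * (c + 1)"
      by (simp add: algebra_simps power2_eq_square)
    ultimately show ?thesis
      using that by (simp flip: add_divide_distrib)
  qed
  have "of_nat CARD('d) \<noteq> (0::complex)" "of_nat CARD('d) - 1 \<noteq> (0::complex)"
    using dim by (auto simp: complex_eq_iff)
  then show ?thesis
    unfolding id_coeff_def swap_coeff_def by (rule *)
qed

section \<open>The measurement channel and its inverse\<close>

text \<open>An entry of the channel is a second moment: \<open>cnj (U $ b $ i) * U $ b $ j\<close>
  is a diagonal entry of the conjugated matrix unit with its 1 in row \<open>j\<close>, column
  \<open>i\<close>. Every outcome \<open>b\<close> contributes equally, and the resulting factor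
  \<open>d\<close> cancels against \<open>d * (d + 1)\<close>.\<close>

lemma meas_channel_eq: "meas_channel M X = (1 / (CARD('d) + 1)) *\<^sub>R (X + mat (ctrace X))"
proof -
  have "meas_channel M X $ i $ j = ((1 / (CARD('d) + 1)) *\<^sub>R (X + mat (ctrace X))) $ i $ j" for i j
  proof -
    let ?E = "(\<chi> a c. if a = j \<and> c = i then 1 else 0) :: complex^'d^'d"
    have E: "uconj U ?E $ b $ b = cnj (U $ b $ i) * U $ b $ j" for U b
    proof -
      have "U $ b $ a * ?E $ a $ c * cnj (U $ b $ c) = (if c = i then if a = j then U $ b $ a * cnj (U $ b $ c) else 0 else 0)" for a c
        by simp
      then show ?thesis unfolding uconj_nth by (simp add: mult.commute)
    qed
    have trE: "ctrace ?E = (if i = j then 1 else 0)"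
    proof -
      have "?E $ a $ a = (if a = j then if i = j then 1 else 0 else 0)" for a by auto
      then show ?thesis unfolding ctrace_def by simp
    qed
    have XE: "ctrace (X ** ?E) = X $ i $ j"
    proof -
      have "X $ a $ c * ?E $ c $ a = (if c = j then if a = i then X $ a $ c else 0 else 0)" for a c
        by simp
      then show ?thesis unfolding ctrace_mult by simp
    qed
    let ?f = "\<lambda>U. \<chi> i j. \<Sum>b\<in>UNIV. uconj U X $ b $ b * cnj (U $ b $ i) * U $ b $ j"
    have f: "integrable M ?f"
      by (intro integrable_cont continuous_intros)
    have "meas_channel M X $ i $ j = (\<integral>U. ?f U $ i $ j \<partial>M)"
      unfolding meas_channel_def
      using integral_bounded_linear[OF bounded_linear_vec_nth f, of i]
        integral_bounded_linear[OF bounded_linear_vec_nth integrable_bounded_linear[OF bounded_linear_vec_nth f], of i j]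
      by simp
    also have "\<dots> = (\<integral>U. (\<Sum>b\<in>UNIV. uconj U X $ b $ b * uconj U ?E $ b $ b) \<partial>M)"
      by (simp add: E mult.assoc)
    also have "\<dots> = (\<Sum>b\<in>UNIV. \<integral>U. uconj U X $ b $ b * uconj U ?E $ b $ b \<partial>M)"
      by (intro Bochner_Integration.integral_sum integrable_cont continuous_intros)
    also have "\<dots> = of_nat CARD('d) * (id_coeff X ?E + swap_coeff X ?E)"
      by (simp only: twirl) simp
    also have "\<dots> = (ctrace X * (if i = j then 1 else 0) + X $ i $ j) / (of_nat CARD('d) + 1)"
      unfolding coeff_sum trE XE by simp
    also have "\<dots> = ((1 / (CARD('d) + 1)) *\<^sub>R (X + mat (ctrace X))) $ i $ j"
      unfolding vector_scaleR_component vector_add_component mat_def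
      by (simp add: scaleR_conv_of_real add.commute)
    finally show ?thesis .
  qed
  then show ?thesis by (simp add: vec_eq_iff)
qed

text \<open>As \<open>meas_inv\<close> is a definite description, a preimage must be exhibited and
  shown unique. The channel equation determines \<open>Y\<close> up to its trace, and its own trace
  reads \<open>(d + 1) * tr Y = (d + 1) * tr A\<close>.\<close>

lemma meas_inv_eq: "meas_inv M A = (CARD('d) + 1) *\<^sub>R A - mat (ctrace A)"
  unfolding meas_inv_def
proof (rule the_equality)
  have tr: "ctrace (r *\<^sub>R Z) = r *\<^sub>R ctrace Z" "ctrace (mat c :: complex^'d^'d) = of_nat CARD('d) * c" 
    "ctrace (Z + Z') = ctrace Z + ctrace Z'" "ctrace (Z - Z') = ctrace Z - ctrace Z'" for r c and Z Z' :: "complex^'d^'d"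
    by (simp_all add: ctrace_def mat_def scaleR_sum_right sum.distrib sum_subtractf)
  have t: "ctrace ((CARD('d) + 1) *\<^sub>R A - mat (ctrace A)) = ctrace A"
    unfolding tr by (simp add: scaleR_conv_of_real algebra_simps)
  show "meas_channel M ((CARD('d) + 1) *\<^sub>R A - mat (ctrace A)) = A"
    unfolding meas_channel_eq t by simp
  fix Y assume Y: "meas_channel M Y = A"
  have Y': "Y + mat (ctrace Y) = (CARD('d) + 1) *\<^sub>R A"
    unfolding Y[symmetric] meas_channel_eq by simp
  then have "ctrace (Y + mat (ctrace Y)) = ctrace ((CARD('d) + 1) *\<^sub>R A)"
    by simp
  then have "(of_nat CARD('d) + 1) * ctrace Y = (of_nat CARD('d) + 1) * ctrace A"
    unfolding tr by (simp add: scaleR_conv_of_real algebra_simps)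
  moreover have "of_nat CARD('d) + 1 \<noteq> (0::complex)"
    by (metis of_nat_Suc of_nat_neq_0 add.commute)
  ultimately have "ctrace Y = ctrace A" by simp
  with Y' show "Y = (CARD('d) + 1) *\<^sub>R A - mat (ctrace A)"
    by (simp add: eq_diff_eq)
qed

end

section \<open>Haar measure and 2-designs as twirling ensembles\<close>

lemma twirling_ensemble_haar:
  fixes H :: "(complex^'d::finite^'d) measure"
  assumes "haar_measure H" "CARD('d) \<ge> 2"
  shows "twirling_ensemble H"
  using assms twirl_haar[OF assms] by unfold_locales (auto simp: haar_measure_def)

text \<open>The moments of \<open>M\<close> agree with those of \<open>H\<close>, so the Haar tensor
  carries over. A concrete \<open>H\<close> is required since the design property compares
  \<open>M\<close> with every given Haar measure.\<close>

lemma twirling_ensemble_2_design: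
  fixes H M :: "(complex^'d::finite^'d) measure"
  assumes H: "haar_measure H" and M: "unitary_2_design M" and d: "CARD('d) \<ge> 2"
  shows "twirling_ensemble M"
proof
  show "unitary_ensemble M" using M by (simp add: unitary_2_design_def)
  then have "(\<integral>U. uconj U X $ i $ j * uconj U Y $ k $ l \<partial>M) = (\<integral>U. uconj U X $ i $ j * uconj U Y $ k $ l \<partial>H)"
    for X Y i j k l
    using H M by (simp add: integral_uconj_eq_moments haar_measure_def unitary_2_design_def)
  then show "(\<integral>U. uconj U X $ i $ j * uconj U Y $ k $ l \<partial>M)
       = (if i = j \<and> k = l then id_coeff X Y else 0) + (if i = l \<and> k = j then swap_coeff X Y else 0)"
    for X Y i j k l
    using twirl_haar[OF H d] by simp
qed (rule d)

section \<open>Exchanging the integrals over two ensembles\<close>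

lemma integral_swap_unitary:
  fixes f :: "complex^'d::finite^'d \<Rightarrow> complex^'d^'d \<Rightarrow> 'b::{banach,second_countable_topology}"
  assumes M: "unitary_ensemble M" and N: "unitary_ensemble N"
    and f: "continuous_on UNIV (\<lambda>(U, W). f U W)"
  shows "(\<integral>W. (\<integral>U. f U W \<partial>M) \<partial>N) = (\<integral>U. (\<integral>W. f U W \<partial>N) \<partial>M)"
    and "integrable N (\<lambda>W. \<integral>U. f U W \<partial>M)"
    and "integrable M (\<lambda>U. \<integral>W. f U W \<partial>N)"
proof -
  interpret M: prob_space M using M by (simp add: unitary_ensemble_def)
  interpret N: prob_space N using N by (simp add: unitary_ensemble_def)
  interpret pair_prob_space M N ..
  note * = integrable_continuous_unitary_pair[OF M N f]
  show "(\<integral>W. (\<integral>U. f U W \<partial>M) \<partial>N) = (\<integral>U. (\<integral>W. f U W \<partial>N) \<partial>M)"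
    by (rule Fubini_integral[OF *])
  show "integrable N (\<lambda>W. \<integral>U. f U W \<partial>M)"
    by (rule integrable_snd[OF *])
  show "integrable M (\<lambda>U. \<integral>W. f U W \<partial>N)"
    using integrable_fst'[OF *] by simp
qed

section \<open>The purity of a density operator\<close>

text \<open>Positivity makes every principal minor of size two nonnegative, which bounds the squared
  modulus of an entry by the product of two diagonal entries. Summing over all entries gives
  \<open>(tr \<rho>)^2 = 1\<close>.\<close>

lemma purity_le_1:
  assumes "density_op (\<rho> :: complex^'d::finite^'d)"
  shows "Re (ctrace (\<rho> ** \<rho>)) \<le> 1"
proof -
  have herm: "hermitian_mat \<rho>" and tr: "ctrace \<rho> = 1"
    and pos: "\<And>v :: complex^'d. 0 \<le> Re (\<Sum>i\<in>UNIV. \<Sum>j\<in>UNIV. cnj (v $ i) * \<rho> $ i $ j * v $ j)"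
    using assms by (auto simp: density_op_def)
  have real: "\<rho> $ i $ i = of_real (Re (\<rho> $ i $ i))" for i
    using hermitian_mat_nth[OF herm, of i i] by (simp add: Reals_cnj_iff[symmetric] flip: of_real_Re)
  have nonneg: "0 \<le> Re (\<rho> $ i $ i)" for i
  proof -
    have "0 \<le> Re (\<Sum>a\<in>UNIV. \<Sum>b\<in>UNIV. cnj (axis i 1 $ a) * \<rho> $ a $ b * axis i 1 $ b)"
      by (rule pos)
    then show ?thesis
      by (simp add: axis_def if_distrib[of "\<lambda>x. x * _"] if_distrib[of "\<lambda>x. _ * x"]
          if_distrib[of cnj] cong: if_cong)
  qed
  have minor: "(cmod (\<rho> $ i $ j))\<^sup>2 \<le> Re (\<rho> $ i $ i) * Re (\<rho> $ j $ j)" for i j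
  proof (cases "i = j")
    case True
    then show ?thesis using real[of i] by (metis norm_of_real power2_abs power2_eq_square order_refl)
  next
    case False
    define c where "c = \<rho> $ i $ j"
    have c': "\<rho> $ j $ i = cnj c"
      using hermitian_mat_nth[OF herm, of i j] by (simp add: c_def)
    have quad: "0 \<le> t\<^sup>2 * Re (\<rho> $ i $ i) + (cmod c)\<^sup>2 * Re (\<rho> $ j $ j) - 2 * t * (cmod c)\<^sup>2" for t
    proof -
      \<comment> \<open>Up to the scaling of the first coordinate, the worst vector for the principal minor on \<open>i, j\<close>.\<close>
      define v :: "complex^'d" where "v = (\<chi> k. (if k = i then of_real t else 0) + (if k = j then - cnj c else 0))"
      have *: "(\<Sum>k\<in>UNIV. f k * v $ k) = f i * of_real t - f j * cnj c" 
        "(\<Sum>k\<in>UNIV. cnj (v $ k) * f k) = of_real t * f i - c * f j" for f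
        unfolding v_def
        by (simp_all add: ring_distribs sum.distrib if_distrib[of "\<lambda>x. x * _"] if_distrib[of "\<lambda>x. _ * x"] if_distrib[of cnj] cong: if_cong)
      have "0 \<le> Re (\<Sum>i\<in>UNIV. cnj (v $ i) * (\<Sum>j\<in>UNIV. \<rho> $ i $ j * v $ j))"
        using pos[of v] by (simp add: sum_distrib_left mult.assoc)
      also have "(\<Sum>i\<in>UNIV. cnj (v $ i) * (\<Sum>j\<in>UNIV. \<rho> $ i $ j * v $ j))
         = of_real (t\<^sup>2) * \<rho> $ i $ i + (c * cnj c) * \<rho> $ j $ j - 2 * of_real t * (c * cnj c)"
        unfolding * c' c_def[symmetric] by (simp add: algebra_simps power2_eq_square)
      finally show ?thesis
        by (simp add: complex_norm_square[symmetric] Re_divide_of_real del: of_real_power)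
    qed
    have "(cmod c)\<^sup>2 \<le> Re (\<rho> $ i $ i) * Re (\<rho> $ j $ j)"
    proof (cases "Re (\<rho> $ i $ i) = 0")
      \<comment> \<open>Here the quadratic in \<open>t\<close> degenerates to an affine function,
        which becomes negative for large \<open>t\<close> if \<open>c\<close> is nonzero.\<close>
      case True
      show ?thesis
      proof (rule ccontr)
        assume "\<not> ?thesis"
        then have "(cmod c)\<^sup>2 > 0" using True by simp
        moreover have "0 \<le> (cmod c)\<^sup>2 * (Re (\<rho> $ j $ j) - 2 * t)" for t
          using quad[of t] True by (simp add: algebra_simps)
        ultimately have "0 \<le> Re (\<rho> $ j $ j) - 2 * t" for t
          by (simp add: zero_le_mult_iff)
        from this[of "Re (\<rho> $ j $ j) / 2 + 1"] show False by simp
      qed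
    next
      case False
      have a: "Re (\<rho> $ i $ i) > 0" using False nonneg[of i] by simp
      \<comment> \<open>With \<open>m\<close> the squared modulus of \<open>c\<close> and
        \<open>x\<close> the diagonal entry at \<open>i\<close>, the point \<open>t = m / x\<close>
        minimises the quadratic; its minimum is the minor up to a nonnegative factor.\<close>
      have "(m / x)\<^sup>2 * x + m * y - 2 * (m / x) * m = m * (x * y - m) / x" if "x > 0" for m x y :: real
        using that by (simp add: field_simps power2_eq_square)
      then have "0 \<le> (cmod c)\<^sup>2 * (Re (\<rho> $ i $ i) * Re (\<rho> $ j $ j) - (cmod c)\<^sup>2) / Re (\<rho> $ i $ i)"
        using quad[of "(cmod c)\<^sup>2 / Re (\<rho> $ i $ i)"] a by simp
      then have "0 \<le> (cmod c)\<^sup>2 * (Re (\<rho> $ i $ i) * Re (\<rho> $ j $ j) - (cmod c)\<^sup>2)"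
        using a by (simp add: zero_le_divide_iff)
      moreover have "0 \<le> Re (\<rho> $ i $ i) * Re (\<rho> $ j $ j)"
        by (intro mult_nonneg_nonneg nonneg)
      ultimately show ?thesis by (cases "c = 0") (auto simp: zero_le_mult_iff)
    qed
    then show ?thesis by (simp add: c_def)
  qed
  have "Re (ctrace (\<rho> ** \<rho>)) = (\<Sum>i\<in>UNIV. \<Sum>j\<in>UNIV. (cmod (\<rho> $ i $ j))\<^sup>2)"
    using hs_norm_hermitian[OF herm] by (simp add: hs_norm_def sum_nonneg)
  also have "\<dots> \<le> (\<Sum>i\<in>UNIV. \<Sum>j\<in>UNIV. Re (\<rho> $ i $ i) * Re (\<rho> $ j $ j))"
    by (intro sum_mono minor)
  also have "\<dots> = (Re (ctrace \<rho>))\<^sup>2"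
    by (simp add: ctrace_def sum_product power2_eq_square)
  finally show ?thesis using tr by simp
qed

section \<open>Averaging a variance over the Haar measure\<close>

lemma continuous_on_mat [continuous_intros]:
  fixes f :: "'a::topological_space \<Rightarrow> complex"
  assumes "continuous_on S f"
  shows "continuous_on S (\<lambda>x. mat (f x) :: complex^'d::finite^'d)"
proof -
  have "continuous_on S (\<lambda>x. if i = j then f x else 0)" for i j :: 'd
    using assms by (cases "i = j") auto
  then show ?thesis unfolding mat_def by (intro continuous_intros)
qed

lemma uconj_scaleR: "uconj U (r *\<^sub>R Z) = r *\<^sub>R (uconj U Z :: complex^'d::finite^'d)"
  by (simp add: vec_eq_iff uconj_nth scaleR_sum_right)

text \<open>The common shape of the four averages: \<open>f\<close> is the integrand of the first
  term, \<open>g\<close> the squared expectation value, and \<open>h\<close> the inner Haar average,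
  which needs to be known for unitary \<open>U\<close> only.\<close>

lemma integral_average_variance:
  fixes f :: "complex^'d::finite^'d \<Rightarrow> complex^'d^'d \<Rightarrow> real"
  assumes M: "unitary_ensemble M" and N: "unitary_ensemble N"
    and f: "continuous_on UNIV (\<lambda>(U, W). f U W)"
    and g: "continuous_on UNIV g" and h: "continuous_on UNIV h"
    and fh: "\<And>U. unitary_mat U \<Longrightarrow> (\<integral>W. f U W \<partial>N) = h U"
  shows "(\<integral>W. (\<integral>U. f U W \<partial>M) - g W \<partial>N) = (\<integral>U. h U \<partial>M) - (\<integral>W. g W \<partial>N)"
proof -
  note swap = integral_swap_unitary[OF M N f]
  have "(\<integral>W. (\<integral>U. f U W \<partial>M) - g W \<partial>N) = (\<integral>W. (\<integral>U. f U W \<partial>M) \<partial>N) - (\<integral>W. g W \<partial>N)"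
    by (intro Bochner_Integration.integral_diff swap integrable_continuous_unitary[OF N g])
  also have "(\<integral>W. (\<integral>U. f U W \<partial>M) \<partial>N) = (\<integral>U. h U \<partial>M)"
    unfolding swap(1)
    using M by (intro integral_cong_AE borel_measurable_integrable swap
      integrable_continuous_unitary[OF M h]) (auto simp: unitary_ensemble_def fh elim!: eventually_mono)
  finally show ?thesis .
qed

text \<open>The fixed \<open>U\<close> is absorbed into the Haar variable. In the applications
  \<open>h\<close> may contain coefficients depending on \<open>U\<close>; only the copy of
  \<open>U\<close> acting on \<open>W\<close> disappears.\<close>

lemma integral_haar_uconj:
  fixes h :: "complex^'d::finite^'d \<Rightarrow> real"
  assumes "haar_measure H" "unitary_mat U" "continuous_on UNIV h"
  shows "(\<integral>W. h (uconj U (uconj W X)) \<partial>H) = (\<integral>W. h (uconj W X) \<partial>H)"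
proof -
  have "continuous_on UNIV (\<lambda>W. h (uconj W X))"
    by (rule continuous_on_compose2[OF assms(3)]) (auto intro!: continuous_intros)
  from integral_haar_left[OF assms(1,2) this] show ?thesis by (simp add: uconj_mult)
qed

text \<open>\<open>D\<close> stands for the dimension, \<open>s\<close> for the trace of the squared
  observable, \<open>w\<close> for the purity. The left-hand sides have the form in which the moment
  formulas deliver them: first the coefficient sums for the observable and the state, then the two
  averages of \<open>shadow_var\<close> and the two of \<open>thrifty_var\<close>.\<close>

lemma variance_identities:
  fixes D s w :: real
  assumes D: "D \<ge> 2"
  shows "- s / D / (D\<^sup>2 - 1) + s / (D\<^sup>2 - 1) = s / (D * (D + 1))"
    and "(1 - w / D) / (D\<^sup>2 - 1) + (w - 1 / D) / (D\<^sup>2 - 1) = (1 + w) / (D * (D + 1))"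
    and "(D + 1)\<^sup>2 * (s / (D * (D + 1))) - (- s / D / (D\<^sup>2 - 1) + s / (D\<^sup>2 - 1) * w)
      = (1 + (D - w) / (D\<^sup>2 - 1)) * s"
    and "(D + 1)\<^sup>2 * (s / (D * (D + 1))) - (w - 1 / D) / (D\<^sup>2 - 1) * s
      = (1 + (D - w) / (D\<^sup>2 - 1)) * s"
    and "(D + 1)\<^sup>2 * (- s / D / (D\<^sup>2 - 1) + s / (D\<^sup>2 - 1) * (D * ((1 + w) / (D * (D + 1)))))
      - (- s / D / (D\<^sup>2 - 1) + s / (D\<^sup>2 - 1) * w) = (D * w - 1) / (D\<^sup>2 - 1) * s"
    and "(w - 1 / D) / (D\<^sup>2 - 1) * ((D + 1)\<^sup>2 * (D * (s / (D * (D + 1)))))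
      - (w - 1 / D) / (D\<^sup>2 - 1) * s = (D * w - 1) / (D\<^sup>2 - 1) * s"
proof -
  have f: "D\<^sup>2 - 1 = (D - 1) * (D + 1)" by (simp add: algebra_simps power2_eq_square)
  have nz: "D - 1 \<noteq> 0" "D + 1 \<noteq> 0" "D \<noteq> 0" using D by auto
  show "- s / D / (D\<^sup>2 - 1) + s / (D\<^sup>2 - 1) = s / (D * (D + 1))"
    unfolding f using nz by (simp add: divide_simps) (simp add: algebra_simps)
  show "(1 - w / D) / (D\<^sup>2 - 1) + (w - 1 / D) / (D\<^sup>2 - 1) = (1 + w) / (D * (D + 1))"
    unfolding f using nz by (simp add: divide_simps) (simp add: algebra_simps)
  show "(D + 1)\<^sup>2 * (s / (D * (D + 1))) - (- s / D / (D\<^sup>2 - 1) + s / (D\<^sup>2 - 1) * w) = (1 + (D - w) / (D\<^sup>2 - 1)) * s"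
    unfolding f using nz by (simp add: divide_simps) (simp add: algebra_simps power2_eq_square)
  show "(D + 1)\<^sup>2 * (s / (D * (D + 1))) - (w - 1 / D) / (D\<^sup>2 - 1) * s = (1 + (D - w) / (D\<^sup>2 - 1)) * s"
    unfolding f using nz by (simp add: divide_simps) (simp add: algebra_simps power2_eq_square)
  show "(D + 1)\<^sup>2 * (- s / D / (D\<^sup>2 - 1) + s / (D\<^sup>2 - 1) * (D * ((1 + w) / (D * (D + 1)))))
      - (- s / D / (D\<^sup>2 - 1) + s / (D\<^sup>2 - 1) * w) = (D * w - 1) / (D\<^sup>2 - 1) * s"
    unfolding f using nz by (simp add: divide_simps) (simp add: algebra_simps power2_eq_square)
  show "(w - 1 / D) / (D\<^sup>2 - 1) * ((D + 1)\<^sup>2 * (D * (s / (D * (D + 1)))))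
      - (w - 1 / D) / (D\<^sup>2 - 1) * s = (D * w - 1) / (D\<^sup>2 - 1) * s"
    unfolding f using nz by (simp add: divide_simps) (simp add: algebra_simps power2_eq_square)
qed

section \<open>The four averaged variances and the strict bound\<close>

theorem theorem1:
  fixes n :: nat and \<U> H :: "(complex^'d::finite^'d) measure" and \<rho> Ob :: "complex^'d^'d"
  assumes "n \<ge> 1" and "CARD('d) = 2 ^ n"
    and "haar_measure H" and "unitary_2_design \<U>"
    and "density_op \<rho>" and "hermitian_mat Ob" and "ctrace Ob = 0"
  shows "(\<integral>W. shadow_var \<U> (W ** Ob ** cadj W) \<rho> \<partial>H) = (\<integral>W. shadow_var \<U> Ob (W ** \<rho> ** cadj W) \<partial>H)
       \<and> (\<integral>W. shadow_var \<U> Ob (W ** \<rho> ** cadj W) \<partial>H)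
           = (1 + (real CARD('d) - Re (ctrace (\<rho> ** \<rho>))) / ((real CARD('d))\<^sup>2 - 1)) * (hs_norm Ob)\<^sup>2
       \<and> (\<integral>W. thrifty_var \<U> (W ** Ob ** cadj W) \<rho> \<partial>H) = (\<integral>W. thrifty_var \<U> Ob (W ** \<rho> ** cadj W) \<partial>H)
       \<and> (\<integral>W. thrifty_var \<U> Ob (W ** \<rho> ** cadj W) \<partial>H)
           = (real CARD('d) * Re (ctrace (\<rho> ** \<rho>)) - 1) / ((real CARD('d))\<^sup>2 - 1) * (hs_norm Ob)\<^sup>2
       \<and> (Ob \<noteq> 0 \<longrightarrow>
           (real CARD('d) * Re (ctrace (\<rho> ** \<rho>)) - 1) / ((real CARD('d))\<^sup>2 - 1) * (hs_norm Ob)\<^sup>2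
             < (hs_norm Ob)\<^sup>2 / real CARD('d))"
proof -
  have "(2::nat) ^ 1 \<le> 2 ^ n" using assms(1) by (intro power_increasing) auto
  then have dim: "CARD('d) \<ge> 2" using assms(2) by simp
  interpret H: twirling_ensemble H
    by (rule twirling_ensemble_haar[OF assms(3) dim])
  interpret \<U>: twirling_ensemble \<U>
    by (rule twirling_ensemble_2_design[OF assms(3,4) dim])
  note average = integral_average_variance[OF \<U>.ensemble H.ensemble]
  have O: "hermitian_mat Ob" "ctrace Ob = 0" and \<rho>: "hermitian_mat \<rho>" "ctrace \<rho> = 1"
    using assms(5-7) by (auto simp: density_op_def)
  define D where "D = real CARD('d)"
  define s where "s = Re (ctrace (Ob ** Ob))"
  define w where "w = Re (ctrace (\<rho> ** \<rho>))"
  have D: "D \<ge> 2" "D > 0" using dim by (simp_all add: D_def)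
  have D2: "D\<^sup>2 - 1 > 0"
    using power_mono[of 2 D 2] D by simp
  have hs: "(hs_norm Ob)\<^sup>2 = s"
    unfolding s_def by (rule hs_norm_hermitian[OF O(1)])

  have D_complex: "of_nat CARD('d) = complex_of_real D" by (simp add: D_def)
  have "ctrace (Ob ** Ob) = of_real s" "ctrace (\<rho> ** \<rho>) = of_real w"
    unfolding s_def w_def
    by (simp_all add: ctrace_hermitian_real O \<rho>)
  then have "id_coeff Ob Ob = of_real (- s / D / (D\<^sup>2 - 1))" "swap_coeff Ob Ob = of_real (s / (D\<^sup>2 - 1))"
    "id_coeff \<rho> \<rho> = of_real ((1 - w / D) / (D\<^sup>2 - 1))" "swap_coeff \<rho> \<rho> = of_real ((w - 1 / D) / (D\<^sup>2 - 1))"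
    unfolding id_coeff_def swap_coeff_def D_complex O \<rho> by simp_all
  then have coeffs: "Re (id_coeff Ob Ob) = - s / D / (D\<^sup>2 - 1)" "Re (swap_coeff Ob Ob) = s / (D\<^sup>2 - 1)"
    "Re (id_coeff \<rho> \<rho>) = (1 - w / D) / (D\<^sup>2 - 1)" "Re (swap_coeff \<rho> \<rho>) = (w - 1 / D) / (D\<^sup>2 - 1)"
    by (simp_all only: Re_complex_of_real)
  note sum_O = variance_identities(1)[OF D(1)] and sum_\<rho> = variance_identities(2)[OF D(1)]

  have minv_O: "meas_inv \<U> Ob = (D + 1) *\<^sub>R Ob"
    unfolding \<U>.meas_inv_eq O D_def by (simp add: mat_def vec_eq_iff)
  \<comment> \<open>Conjugation preserves the trace for unitary \<open>W\<close> only. The averages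
    over the observable therefore pass the full formula for the inverse, continuous on all matrices,
    to \<open>average\<close> and simplify it afterwards on unitaries.\<close>
  have minv_WO: "(CARD('d) + 1) *\<^sub>R uconj W Ob - mat (ctrace (uconj W Ob)) = (D + 1) *\<^sub>R uconj W Ob"
    if "unitary_mat W" for W
    unfolding ctrace_uconj[OF that] O D_def by (simp add: mat_def vec_eq_iff)
  have sum_diag: "(\<Sum>b\<in>UNIV. Re (uconj U X $ b $ b)) = Re (ctrace X)" if "unitary_mat U" for U X
    using ctrace_uconj[OF that, of X] by (simp add: ctrace_def flip: Re_sum)

  \<comment> \<open>The squared expectation values are second Haar moments. Both choices of the
    conjugated operator give the same number, in different arrangements.\<close>
  have overlap_O: "(\<integral>W. (Re (ctrace (uconj W Ob ** \<rho>)))\<^sup>2 \<partial>H) = - s / D / (D\<^sup>2 - 1) + s / (D\<^sup>2 - 1) * w"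
  proof -
    have "ctrace (uconj W Ob ** \<rho>) = ctrace (\<rho> ** uconj W Ob)" for W
      by (rule ctrace_mult_commute)
    then show ?thesis
      using H.integral_Re_ctrace_sq[OF \<rho>(1) O(1)]
      unfolding coeffs \<rho>(2) w_def[symmetric] by simp
  qed
  have overlap_\<rho>: "(\<integral>W. (Re (ctrace (Ob ** uconj W \<rho>)))\<^sup>2 \<partial>H) = (w - 1 / D) / (D\<^sup>2 - 1) * s"
    using H.integral_Re_ctrace_sq[OF O(1) \<rho>(1)]
    unfolding coeffs O(2) s_def[symmetric] by simp

  \<comment> \<open>Once \<open>U\<close> is absorbed, the Haar average of the squared entry is the
    same for every outcome. As the outcome probabilities sum to 1, the inner average is constant in
    \<open>U\<close>.\<close>
  have shadow_O: "(\<integral>W. shadow_var \<U> (uconj W Ob) \<rho> \<partial>H)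
    = (D + 1)\<^sup>2 * (s / (D * (D + 1))) - (- s / D / (D\<^sup>2 - 1) + s / (D\<^sup>2 - 1) * w)"
  proof -
    have "(\<integral>W. shadow_var \<U> (uconj W Ob) \<rho> \<partial>H)
      = (\<integral>U. (D + 1)\<^sup>2 * (s / (D * (D + 1))) \<partial>\<U>) - (\<integral>W. (Re (ctrace (uconj W Ob ** \<rho>)))\<^sup>2 \<partial>H)"
      unfolding shadow_var_def \<U>.meas_inv_eq
    proof (rule average)
      fix U :: "complex^'d^'d" assume U: "unitary_mat U"
      let ?p = "\<lambda>b. Re (uconj U \<rho> $ b $ b)"
      have "(\<integral>W. (\<Sum>b\<in>UNIV. ?p b * (Re (uconj U ((CARD('d) + 1) *\<^sub>R uconj W Ob - mat (ctrace (uconj W Ob))) $ b $ b))\<^sup>2) \<partial>H)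
        = (\<integral>W. (\<Sum>b\<in>UNIV. ?p b * (Re (((D + 1) *\<^sub>R uconj U (uconj W Ob)) $ b $ b))\<^sup>2) \<partial>H)"
        by (intro H.integral_cong_unitary continuous_intros) (simp only: minv_WO uconj_scaleR)
      also have "\<dots> = (\<integral>W. (\<Sum>b\<in>UNIV. ?p b * (Re (((D + 1) *\<^sub>R uconj W Ob) $ b $ b))\<^sup>2) \<partial>H)"
        by (intro integral_haar_uconj[OF assms(3) U] continuous_intros)
      also have "\<dots> = (\<integral>W. (\<Sum>b\<in>UNIV. ?p b * (D + 1)\<^sup>2 * (Re (uconj W Ob $ b $ b))\<^sup>2) \<partial>H)"
        by (simp add: power_mult_distrib mult.assoc)
      also have "\<dots> = (\<Sum>b\<in>UNIV. \<integral>W. ?p b * (D + 1)\<^sup>2 * (Re (uconj W Ob $ b $ b))\<^sup>2 \<partial>H)"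
        by (intro Bochner_Integration.integral_sum H.integrable_cont continuous_intros)
      also have "\<dots> = (\<Sum>b\<in>UNIV. ?p b * (D + 1)\<^sup>2 * (s / (D * (D + 1))))"
        unfolding integral_mult_right_zero H.integral_diag_nth_sq[OF O(1)] coeffs sum_O ..
      also have "\<dots> = (D + 1)\<^sup>2 * (s / (D * (D + 1)))"
        unfolding sum_distrib_right[symmetric] sum_diag[OF U] \<rho>(2) by simp
      finally show "(\<integral>W. (\<Sum>b\<in>UNIV. ?p b * (Re (uconj U ((CARD('d) + 1) *\<^sub>R uconj W Ob - mat (ctrace (uconj W Ob))) $ b $ b))\<^sup>2) \<partial>H)
        = (D + 1)\<^sup>2 * (s / (D * (D + 1)))" .
    \<comment> \<open>What remains of \<open>average\<close> is the continuity of its three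
      functions; the unfolding is for the one defined on pairs.\<close>
    qed ((unfold case_prod_unfold)?, intro continuous_intros)+
    then show ?thesis unfolding overlap_O by (simp add: \<U>.prob_space)
  qed

  \<comment> \<open>The Haar average of each outcome probability is \<open>1 / D\<close>. What is
    left in \<open>U\<close> are squared diagonal entries of the conjugated observable, a second
    moment of the design.\<close>
  have shadow_\<rho>: "(\<integral>W. shadow_var \<U> Ob (uconj W \<rho>) \<partial>H)
    = (D + 1)\<^sup>2 * (s / (D * (D + 1))) - (w - 1 / D) / (D\<^sup>2 - 1) * s"
  proof -
    have "(\<integral>W. shadow_var \<U> Ob (uconj W \<rho>) \<partial>H)
      = (\<integral>U. (\<Sum>b\<in>UNIV. (D + 1)\<^sup>2 / D * (Re (uconj U Ob $ b $ b))\<^sup>2) \<partial>\<U>)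
        - (\<integral>W. (Re (ctrace (Ob ** uconj W \<rho>)))\<^sup>2 \<partial>H)"
      unfolding shadow_var_def minv_O
    proof (rule average)
      fix U :: "complex^'d^'d" assume U: "unitary_mat U"
      let ?o = "\<lambda>b. (Re (uconj U ((D + 1) *\<^sub>R Ob) $ b $ b))\<^sup>2"
      have "(\<integral>W. (\<Sum>b\<in>UNIV. Re (uconj U (uconj W \<rho>) $ b $ b) * ?o b) \<partial>H)
        = (\<integral>W. (\<Sum>b\<in>UNIV. Re (uconj W \<rho> $ b $ b) * ?o b) \<partial>H)"
        by (intro integral_haar_uconj[OF assms(3) U] continuous_intros)
      also have "\<dots> = (\<Sum>b\<in>UNIV. \<integral>W. Re (uconj W \<rho> $ b $ b) * ?o b \<partial>H)"
        by (intro Bochner_Integration.integral_sum H.integrable_cont continuous_intros)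
      also have "\<dots> = (\<Sum>b\<in>UNIV. 1 / D * ?o b)"
        unfolding integral_mult_left_zero H.integral_diag_nth \<rho>(2) D_def by simp
      also have "\<dots> = (\<Sum>b\<in>UNIV. (D + 1)\<^sup>2 / D * (Re (uconj U Ob $ b $ b))\<^sup>2)"
        unfolding uconj_scaleR by (simp add: power_mult_distrib)
      finally show "(\<integral>W. (\<Sum>b\<in>UNIV. Re (uconj U (uconj W \<rho>) $ b $ b) * ?o b) \<partial>H)
        = (\<Sum>b\<in>UNIV. (D + 1)\<^sup>2 / D * (Re (uconj U Ob $ b $ b))\<^sup>2)" .
    qed ((unfold case_prod_unfold)?, intro continuous_intros)+
    also have "(\<integral>U. (\<Sum>b\<in>UNIV. (D + 1)\<^sup>2 / D * (Re (uconj U Ob $ b $ b))\<^sup>2) \<partial>\<U>)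
      = (\<Sum>b\<in>UNIV. \<integral>U. (D + 1)\<^sup>2 / D * (Re (uconj U Ob $ b $ b))\<^sup>2 \<partial>\<U>)"
      by (intro Bochner_Integration.integral_sum \<U>.integrable_cont continuous_intros)
    also have "\<dots> = D * ((D + 1)\<^sup>2 / D * (s / (D * (D + 1))))"
      unfolding integral_mult_right_zero \<U>.integral_diag_nth_sq[OF O(1)] coeffs sum_O
      by (simp add: D_def)
    finally show ?thesis unfolding overlap_\<rho> using D by simp
  qed

  \<comment> \<open>The inner Haar average is that of a squared weighted sum, with the outcome
    probabilities as weights. Their sum is 1; the sum of their squares is integrated over
    \<open>U\<close> as a second moment of the state.\<close>
  have thrifty_O: "(\<integral>W. thrifty_var \<U> (uconj W Ob) \<rho> \<partial>H)
    = (D + 1)\<^sup>2 * (- s / D / (D\<^sup>2 - 1) + s / (D\<^sup>2 - 1) * (D * ((1 + w) / (D * (D + 1)))))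
      - (- s / D / (D\<^sup>2 - 1) + s / (D\<^sup>2 - 1) * w)"
  proof -
    have "(\<integral>W. thrifty_var \<U> (uconj W Ob) \<rho> \<partial>H)
      = (\<integral>U. (D + 1)\<^sup>2 * (- s / D / (D\<^sup>2 - 1) + s / (D\<^sup>2 - 1) * (\<Sum>b\<in>UNIV. (Re (uconj U \<rho> $ b $ b))\<^sup>2)) \<partial>\<U>)
        - (\<integral>W. (Re (ctrace (uconj W Ob ** \<rho>)))\<^sup>2 \<partial>H)"
      unfolding thrifty_var_def \<U>.meas_inv_eq
    proof (rule average)
      fix U :: "complex^'d^'d" assume U: "unitary_mat U"
      let ?p = "\<lambda>b. Re (uconj U \<rho> $ b $ b)"
      have "(\<integral>W. (\<Sum>b\<in>UNIV. ?p b * Re (uconj U ((CARD('d) + 1) *\<^sub>R uconj W Ob - mat (ctrace (uconj W Ob))) $ b $ b))\<^sup>2 \<partial>H)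
        = (\<integral>W. (\<Sum>b\<in>UNIV. ?p b * Re (((D + 1) *\<^sub>R uconj U (uconj W Ob)) $ b $ b))\<^sup>2 \<partial>H)"
        by (intro H.integral_cong_unitary continuous_intros) (simp only: minv_WO uconj_scaleR)
      also have "\<dots> = (\<integral>W. (\<Sum>b\<in>UNIV. ?p b * Re (((D + 1) *\<^sub>R uconj W Ob) $ b $ b))\<^sup>2 \<partial>H)"
        by (intro integral_haar_uconj[OF assms(3) U] continuous_intros)
      also have "\<dots> = (\<integral>W. (D + 1)\<^sup>2 * (\<Sum>b\<in>UNIV. ?p b * Re (uconj W Ob $ b $ b))\<^sup>2 \<partial>H)"
        by (simp add: mult.left_commute[of "Re _" "D + 1"] power_mult_distrib flip: sum_distrib_left)
      also have "\<dots> = (D + 1)\<^sup>2 * (- s / D / (D\<^sup>2 - 1) + s / (D\<^sup>2 - 1) * (\<Sum>b\<in>UNIV. (?p b)\<^sup>2))"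
        unfolding integral_mult_right_zero H.integral_diag_sum_sq[OF O(1)] coeffs sum_diag[OF U] \<rho>(2)
        by simp
      finally show "(\<integral>W. (\<Sum>b\<in>UNIV. ?p b * Re (uconj U ((CARD('d) + 1) *\<^sub>R uconj W Ob - mat (ctrace (uconj W Ob))) $ b $ b))\<^sup>2 \<partial>H)
        = (D + 1)\<^sup>2 * (- s / D / (D\<^sup>2 - 1) + s / (D\<^sup>2 - 1) * (\<Sum>b\<in>UNIV. (?p b)\<^sup>2))" .
    qed ((unfold case_prod_unfold)?, intro continuous_intros)+
    also have "(\<integral>U. (D + 1)\<^sup>2 * (- s / D / (D\<^sup>2 - 1) + s / (D\<^sup>2 - 1) * (\<Sum>b\<in>UNIV. (Re (uconj U \<rho> $ b $ b))\<^sup>2)) \<partial>\<U>)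
      = (D + 1)\<^sup>2 * (- s / D / (D\<^sup>2 - 1) + s / (D\<^sup>2 - 1) * (\<integral>U. (\<Sum>b\<in>UNIV. (Re (uconj U \<rho> $ b $ b))\<^sup>2) \<partial>\<U>))"
    proof -
      have "integrable \<U> (\<lambda>U. \<Sum>b\<in>UNIV. (Re (uconj U \<rho> $ b $ b))\<^sup>2)"
        by (intro \<U>.integrable_cont continuous_intros)
      then show ?thesis by (simp add: \<U>.prob_space)
    qed
    also have "(\<integral>U. (\<Sum>b\<in>UNIV. (Re (uconj U \<rho> $ b $ b))\<^sup>2) \<partial>\<U>)
      = (\<Sum>b\<in>UNIV. \<integral>U. (Re (uconj U \<rho> $ b $ b))\<^sup>2 \<partial>\<U>)"
      by (intro Bochner_Integration.integral_sum \<U>.integrable_cont continuous_intros)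
    also have "\<dots> = D * ((1 + w) / (D * (D + 1)))"
      unfolding \<U>.integral_diag_nth_sq[OF \<rho>(1)] coeffs sum_\<rho> by (simp add: D_def)
    finally show ?thesis unfolding overlap_O .
  qed

  \<comment> \<open>The roles are exchanged: the weights are the diagonal entries of the conjugated,
    rescaled observable. They sum to zero, so only the swap coefficient of the state
    survives.\<close>
  have thrifty_\<rho>: "(\<integral>W. thrifty_var \<U> Ob (uconj W \<rho>) \<partial>H)
    = (w - 1 / D) / (D\<^sup>2 - 1) * ((D + 1)\<^sup>2 * (D * (s / (D * (D + 1)))))
      - (w - 1 / D) / (D\<^sup>2 - 1) * s"
  proof -
    have "(\<integral>W. thrifty_var \<U> Ob (uconj W \<rho>) \<partial>H)
      = (\<integral>U. (w - 1 / D) / (D\<^sup>2 - 1) * ((D + 1)\<^sup>2 * (\<Sum>b\<in>UNIV. (Re (uconj U Ob $ b $ b))\<^sup>2)) \<partial>\<U>)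
        - (\<integral>W. (Re (ctrace (Ob ** uconj W \<rho>)))\<^sup>2 \<partial>H)"
      unfolding thrifty_var_def minv_O
    proof (rule average)
      fix U :: "complex^'d^'d" assume U: "unitary_mat U"
      let ?o = "\<lambda>b. Re (uconj U ((D + 1) *\<^sub>R Ob) $ b $ b)"
      have o: "?o b = (D + 1) * Re (uconj U Ob $ b $ b)" for b
        unfolding uconj_scaleR by simp
      have "(\<Sum>b\<in>UNIV. ?o b) = (D + 1) * Re (ctrace Ob)"
        unfolding o sum_distrib_left[symmetric] sum_diag[OF U] ..
      then have o0: "(\<Sum>b\<in>UNIV. ?o b) = 0" by (simp add: O(2))
      have "(\<integral>W. (\<Sum>b\<in>UNIV. Re (uconj U (uconj W \<rho>) $ b $ b) * ?o b)\<^sup>2 \<partial>H)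
        = (\<integral>W. (\<Sum>b\<in>UNIV. Re (uconj W \<rho> $ b $ b) * ?o b)\<^sup>2 \<partial>H)"
        by (intro integral_haar_uconj[OF assms(3) U] continuous_intros)
      also have "\<dots> = (w - 1 / D) / (D\<^sup>2 - 1) * (\<Sum>b\<in>UNIV. (?o b)\<^sup>2)"
        unfolding mult.commute[of _ "?o _"] H.integral_diag_sum_sq[OF \<rho>(1)] coeffs o0 by simp
      also have "\<dots> = (w - 1 / D) / (D\<^sup>2 - 1) * ((D + 1)\<^sup>2 * (\<Sum>b\<in>UNIV. (Re (uconj U Ob $ b $ b))\<^sup>2))"
        unfolding o power_mult_distrib sum_distrib_left ..
      finally show "(\<integral>W. (\<Sum>b\<in>UNIV. Re (uconj U (uconj W \<rho>) $ b $ b) * ?o b)\<^sup>2 \<partial>H)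
        = (w - 1 / D) / (D\<^sup>2 - 1) * ((D + 1)\<^sup>2 * (\<Sum>b\<in>UNIV. (Re (uconj U Ob $ b $ b))\<^sup>2))" .
    qed ((unfold case_prod_unfold)?, intro continuous_intros)+
    also have "(\<integral>U. (w - 1 / D) / (D\<^sup>2 - 1) * ((D + 1)\<^sup>2 * (\<Sum>b\<in>UNIV. (Re (uconj U Ob $ b $ b))\<^sup>2)) \<partial>\<U>)
      = (w - 1 / D) / (D\<^sup>2 - 1) * ((D + 1)\<^sup>2 * (\<integral>U. (\<Sum>b\<in>UNIV. (Re (uconj U Ob $ b $ b))\<^sup>2) \<partial>\<U>))"
      by (simp only: integral_mult_right_zero)
    also have "(\<integral>U. (\<Sum>b\<in>UNIV. (Re (uconj U Ob $ b $ b))\<^sup>2) \<partial>\<U>)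
      = (\<Sum>b\<in>UNIV. \<integral>U. (Re (uconj U Ob $ b $ b))\<^sup>2 \<partial>\<U>)"
      by (intro Bochner_Integration.integral_sum \<U>.integrable_cont continuous_intros)
    also have "\<dots> = D * (s / (D * (D + 1)))"
      unfolding \<U>.integral_diag_nth_sq[OF O(1)] coeffs sum_O by (simp add: D_def)
    finally show ?thesis unfolding overlap_\<rho> .
  qed

  \<comment> \<open>For \<open>Ob = 0\<close> both sides vanish, hence the guard. Otherwise
    \<open>w \<le> 1\<close> gives \<open>D * (D * w - 1) \<le> D^2 - D < D^2 - 1\<close>, strictly
    because \<open>D > 1\<close>.\<close>
  have strict: "(D * w - 1) / (D\<^sup>2 - 1) * s < s / D" if "Ob \<noteq> 0"
  proof -
    have "s > 0"
    proof -
      obtain i j where ij: "Ob $ i $ j \<noteq> 0" using \<open>Ob \<noteq> 0\<close> by (auto simp: vec_eq_iff)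
      have "0 < (\<Sum>i\<in>UNIV. \<Sum>j\<in>UNIV. (cmod (Ob $ i $ j))\<^sup>2)"
        using ij by (intro sum_pos2[of _ i] sum_pos2[of _ j]) (auto intro!: sum_nonneg)
      then show ?thesis unfolding hs[symmetric] hs_norm_def by simp
    qed
    moreover have "(D * w - 1) / (D\<^sup>2 - 1) < 1 / D"
    proof -
      have "w \<le> 1" unfolding w_def by (rule purity_le_1[OF assms(5)])
      then have "D * (D * w - 1) \<le> D * (D * 1 - 1)"
        using D by (intro mult_left_mono diff_right_mono) auto
      also have "\<dots> < D\<^sup>2 - 1"
        using D by (simp add: algebra_simps power2_eq_square)
      finally have "D * (D * w - 1) < D\<^sup>2 - 1" .
      then show ?thesis using D D2 by (simp add: divide_less_eq less_divide_eq mult.commute)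
    qed
    ultimately show ?thesis using mult_strict_right_mono[of "(D * w - 1) / (D\<^sup>2 - 1)" "1 / D" s] by simp
  qed
  show ?thesis
    unfolding shadow_O shadow_\<rho> thrifty_O thrifty_\<rho> hs D_def[symmetric] w_def[symmetric]
      variance_identities(3-6)[OF D(1)]
    using strict by blast
qed

end
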